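(* Let $\{\mathcal{T}(t)\}_{t\ge 0}$ be the asymmetric telegraph process with velocities $c_1,-c_2$ ($c_1,c_2>0$) and rate $\lambda>0$, and let $t>0$. For every integer $k\ge 0$ and every $\beta\in[0,c_1t]$, $$P\Big\{\max_{0\le s\le t}\mathcal{T}(s)\le\beta\ \Big|\ V(0)=-c_2,\ N(t)=2k\Big\}=\sum_{j=0}^{k}\binom{2k}{j}\frac{(c_1t-\beta)^{j}(c_2t+\beta)^{2k-j}}{[(c_1+c_2)t]^{2k}}-\sum_{j=0}^{k-1}\binom{2k}{j}\Big(\frac{c_2}{c_1}\Big)^{2k-1-2j}\frac{(c_1t-\beta)^{2k-j}(c_2t+\beta)^{j}}{[(c_1+c_2)t]^{2k}}.$$
   Context: Asymmetric telegraph process: let $c_1,c_2>0$, $\lambda>0$. Let $\{N(t)\}_{t\ge0}$ be a homogeneous Poisson process with rate $\lambda$, and let $V(0)$ be a random variable independent of $N$ with $P\{V(0)=c_1\}=P\{V(0)=-c_2\}=\frac12$. The velocity $V(s)$ takes values in $\{c_1,-c_2\}$, starts at $V(0)$, and switches from one of these two values to the other at each event of $N$, remaining constant between events. The position of the particle is $\mathcal{T}(t)=\int_0^t V(s)\,ds$ (so $\mathcal{T}(0)=0$). Empty sums are $0$, and $0^0=1$. *)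

theory Defs
  imports "HOL-Probability.Probability"
begin

text \<open>
  Homogeneous Poisson process on \<open>[0,\<infinity>)\<close>, with counting-process paths. Only the values
  \<open>N s\<close> for \<open>s \<ge> 0\<close> are constrained. By monotonicity the truncated subtraction on
  \<^typ>\<open>nat\<close> gives the true increments.
\<close>

locale poisson_process = prob_space M
  for M :: "'a measure" +
  fixes rate :: real and N :: "real \<Rightarrow> 'a \<Rightarrow> nat"
  assumes rate_pos: "0 < rate"
    and count_measurable: "\<And>s. 0 \<le> s \<Longrightarrow> random_variable (count_space UNIV) (N s)"
    and count_zero: "\<And>\<omega>. \<omega> \<in> space M \<Longrightarrow> N 0 \<omega> = 0"
    and count_mono: "\<And>\<omega>. \<omega> \<in> space M \<Longrightarrow> mono_on {0..} (\<lambda>s. N s \<omega>)"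
    and count_right_continuous:
      "\<And>\<omega> s. \<omega> \<in> space M \<Longrightarrow> 0 \<le> s \<Longrightarrow> continuous (at_right s) (\<lambda>u. N u \<omega>)"
    and independent_increments:
      "\<And>(\<tau> :: nat \<Rightarrow> real) n. 0 \<le> \<tau> 0 \<Longrightarrow> strict_mono_on {..n} \<tau> \<Longrightarrow>
         indep_vars (\<lambda>_. count_space UNIV) (\<lambda>i \<omega>. N (\<tau> (Suc i)) \<omega> - N (\<tau> i) \<omega>) {..<n}"
    and poisson_increments:
      "\<And>s t. 0 \<le> s \<Longrightarrow> s < t \<Longrightarrow>
         distr M (count_space UNIV) (\<lambda>\<omega>. N t \<omega> - N s \<omega>)
           = measure_pmf (poisson_pmf (rate * (t - s)))"

text \<open>
  The data driving the telegraph process: a Poisson process \<open>N\<close> and an initial velocity \<open>V0\<close>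
  that is uniform on \<open>{c1, -c2}\<close> and independent of the whole process \<open>N\<close>. The independence is
  stated for the generated sigma-algebras, since \<open>indep_var\<close> needs a common value type.
\<close>

locale asymmetric_telegraph = poisson_process M rate N
  for M :: "'a measure" and rate :: real and N :: "real \<Rightarrow> 'a \<Rightarrow> nat" +
  fixes c1 c2 :: real and V0 :: "'a \<Rightarrow> real"
  assumes c1_pos: "0 < c1" and c2_pos: "0 < c2"
    and V0_measurable: "random_variable borel V0"
    and V0_up: "\<P>(\<omega> in M. V0 \<omega> = c1) = 1 / 2"
    and V0_down: "\<P>(\<omega> in M. V0 \<omega> = - c2) = 1 / 2"
    and V0_indep_N:
      "indep_set
         (sets (vimage_algebra (space M) V0 borel))
         (sets (vimage_algebra (space M) (\<lambda>\<omega>. \<lambda>s\<in>{0..}. N s \<omega>)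
                  (\<Pi>\<^sub>M s\<in>{0::real..}. count_space (UNIV :: nat set))))"

definition switch_velocity :: "real \<Rightarrow> real \<Rightarrow> real \<Rightarrow> real" where
  "switch_velocity c1 c2 v = (if v = c1 then - c2 else c1)"

text \<open>One switch for each of the \<open>N s \<omega>\<close> events up to time \<open>s\<close>.\<close>

definition velocity ::
  "real \<Rightarrow> real \<Rightarrow> ('a \<Rightarrow> real) \<Rightarrow> (real \<Rightarrow> 'a \<Rightarrow> nat) \<Rightarrow> real \<Rightarrow> 'a \<Rightarrow> real" where
  "velocity c1 c2 V0 N s \<omega> = (switch_velocity c1 c2 ^^ N s \<omega>) (V0 \<omega>)"

definition telegraph ::
  "real \<Rightarrow> real \<Rightarrow> ('a \<Rightarrow> real) \<Rightarrow> (real \<Rightarrow> 'a \<Rightarrow> nat) \<Rightarrow> real \<Rightarrow> 'a \<Rightarrow> real" where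
  "telegraph c1 c2 V0 N t \<omega> = integral {0..t} (\<lambda>s. velocity c1 c2 V0 N s \<omega>)"

text \<open>
  For a path that is continuous on \<open>[0,t]\<close>, such as a telegraph path, this supremum is attained,
  hence is the maximum (\<^const>\<open>Max\<close> is meaningful for finite sets only).
\<close>

definition running_max :: "(real \<Rightarrow> 'a \<Rightarrow> real) \<Rightarrow> real \<Rightarrow> 'a \<Rightarrow> real" where
  "running_max X t \<omega> = (SUP s\<in>{0..t}. X s \<omega>)"

end

theory Submission
  imports Defs
begin

text \<open>
  Suppose the particle starts downwards and let \<open>J\<^sub>1 \<le> J\<^sub>2 \<le> \<dots>\<close> be the event times of \<open>N\<close>. On
  \<open>{N t = 2k}\<close> the path is piecewise linear with nodes at the \<open>J\<^sub>j\<close>, so its maximum over \<open>[0,t]\<close> is at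
  most \<open>\<beta>\<close> exactly if the positions at \<open>J\<^sub>0, \<dots>, J\<^sub>2\<^sub>k\<close> are (lemma \<open>running_max_le_iff\<close>).

  The right coordinates for this constraint are \<open>x = c1 s - b\<close> and \<open>y = c2 s + b\<close>, where \<open>s\<close> is the
  remaining time and \<open>b\<close> the remaining distance to the level \<open>\<beta>\<close>. A downward leg of duration \<open>r\<close>
  decreases \<open>x\<close> by \<open>(c1 + c2) r\<close> and leaves \<open>y\<close> alone; an upward leg does the converse. The conditions
  \<open>s \<ge> 0\<close> and \<open>b \<ge> 0\<close> become \<open>x + y \<ge> 0\<close> and \<open>c2 x \<le> c1 y\<close>, the region \<open>safe\<close>. Thus the embedded
  process is a walk that moves alternately left and down by independent exponential amounts and that has
  to stay in a wedge.

  Let \<open>survival m z\<close> be the probability, with \<open>m\<close> events still to come, that the walk from \<open>z\<close> stays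
  safe for \<open>m\<close> moves and that no further event occurs before the horizon. Conditioning on the next
  waiting time expresses \<open>survival (m + 1)\<close> as an integral of \<open>survival m\<close>. The exponential factors
  combine to \<open>(\<lambda> / (c1 + c2))\<^sup>m exp (- \<lambda> s)\<close>, and what remains is a volume satisfying
  \<open>\<partial>\<^sub>x g\<^sub>k\<^sub>+\<^sub>1 = h\<^sub>k\<close>, \<open>\<partial>\<^sub>y h\<^sub>k = g\<^sub>k\<close>, with \<open>h\<^sub>k = 0\<close> on the barrier \<open>y = \<rho> x\<close>, \<open>\<rho> = c2 / c1\<close>, and with
  the free value \<open>y\<^sup>2\<^sup>k / (2k)!\<close> of \<open>g\<^sub>k\<close> at \<open>x = 0\<close>. The polynomials \<open>down_poly\<close> and \<open>up_poly\<close> solve this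
  system. In both, the first sum carries the boundary value at \<open>x = 0\<close>. In \<open>h\<^sub>k\<close> the second sum is the
  image of the first one under the reflection \<open>x \<mapsto> y / \<rho>\<close>, \<open>y \<mapsto> \<rho> x\<close>, which makes \<open>h\<^sub>k\<close> vanish on the
  barrier; integrating in \<open>x\<close> gives the second sum of \<open>g\<^sub>k\<^sub>+\<^sub>1\<close>. Lemma \<open>survival_eq\<close> puts this together.

  The probabilistic input is that each waiting time is exponential and independent of the earlier ones
  (lemmas \<open>waiting_time_distributed\<close> and \<open>waiting_time_indep\<close>). It is derived from the independence of
  increments by rounding the event time \<open>J\<^sub>i\<close> up to a grid, where the next increment is independent of
  the past, and then refining the grid. With it, \<open>survival\<close> evaluated along the walk is a martingale
  (lemma \<open>survival_martingale\<close>), which identifies the joint probability of \<open>N t = 2k\<close> and the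
  constraint. Dividing by the Poisson probability of \<open>N t = 2k\<close> removes \<open>\<lambda>\<close>, and the independent initial
  velocity cancels.
\<close>

section \<open>Jump times of counting paths\<close>

text \<open>
  If the path stays below \<open>j\<close>, the set is empty and the value is the unspecified real \<open>Inf {}\<close>. Statements
  that compare it with the counts therefore assume that level \<open>j\<close> is reached.
\<close>

definition jump_time :: "(real \<Rightarrow> nat) \<Rightarrow> nat \<Rightarrow> real" where
  "jump_time f j = Inf {s. 0 \<le> s \<and> j \<le> f s}"

abbreviation gap :: "(real \<Rightarrow> nat) \<Rightarrow> nat \<Rightarrow> real" where
  "gap f j \<equiv> jump_time f (Suc j) - jump_time f j"

locale counting_path =
  fixes f :: "real \<Rightarrow> nat"
  assumes path_mono: "mono_on {0..} f"
    and path_right_continuous: "\<And>s. 0 \<le> s \<Longrightarrow> continuous (at_right s) f"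
    and path_zero: "f 0 = 0"
begin

lemma path_le: "0 \<le> s \<Longrightarrow> s \<le> u \<Longrightarrow> f s \<le> f u"
  using path_mono by (auto simp: mono_on_def)

lemma path_locally_constant:
  assumes "0 \<le> s"
  obtains b where "s < b" "\<And>u. s \<le> u \<Longrightarrow> u < b \<Longrightarrow> f u = f s"
proof -
  have "(f \<longlongrightarrow> f s) (at_right s)"
    using path_right_continuous[OF assms] by (simp add: continuous_within)
  then have "eventually (\<lambda>u. f u = f s) (at_right s)"
    by (simp add: tendsto_discrete)
  then obtain b where "s < b" "\<forall>u>s. u < b \<longrightarrow> f u = f s"
    by (auto simp: eventually_at_right_field)
  then show ?thesis by (intro that[of b]) (auto simp: le_less)
qed

lemma jump_time_nonneg: "\<exists>s\<ge>0. j \<le> f s \<Longrightarrow> 0 \<le> jump_time f j"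
  unfolding jump_time_def by (rule cInf_greatest) auto

text \<open>
  By right continuity the level \<open>j\<close> is attained at the infimum itself. This turns every statement about
  event times into one about counts.
\<close>

lemma jump_time_le_iff:
  assumes reach: "\<exists>s\<ge>0. j \<le> f s" and u: "0 \<le> u"
  shows "jump_time f j \<le> u \<longleftrightarrow> j \<le> f u"
proof
  let ?S = "{s. 0 \<le> s \<and> j \<le> f s}"
  have bdd: "bdd_below ?S" by (rule bdd_belowI[of _ 0]) auto
  show "jump_time f j \<le> u" if "j \<le> f u"
    unfolding jump_time_def using bdd that u by (intro cInf_lower) auto
  assume le: "jump_time f j \<le> u"
  have J: "0 \<le> jump_time f j" by (rule jump_time_nonneg[OF reach])
  from path_locally_constant[OF J] obtain b where b: "jump_time f j < b"
    "\<And>u. jump_time f j \<le> u \<Longrightarrow> u < b \<Longrightarrow> f u = f (jump_time f j)" by blast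
  have "\<exists>s\<in>?S. s < b"
    by (rule cInf_lessD) (use reach b in \<open>auto simp: jump_time_def\<close>)
  then obtain s where s: "s \<in> ?S" "s < b" by blast
  have "jump_time f j \<le> s" unfolding jump_time_def by (rule cInf_lower[OF s(1) bdd])
  from b(2)[OF this s(2)] s(1) have "j \<le> f (jump_time f j)" by simp
  also have "\<dots> \<le> f u" by (rule path_le[OF J le])
  finally show "j \<le> f u" .
qed

lemma jump_time_0 [simp]: "jump_time f 0 = 0"
  using jump_time_le_iff[of 0 0] jump_time_nonneg[of 0] by (auto intro: antisym)

lemma reach_mono: "\<exists>s\<ge>0. j \<le> f s \<Longrightarrow> i \<le> j \<Longrightarrow> \<exists>s\<ge>0. i \<le> f s"
  by (meson order_trans)

lemma jump_time_mono:
  assumes "\<exists>s\<ge>0. j \<le> f s" "i \<le> j"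
  shows "jump_time f i \<le> jump_time f j"
proof -
  have "j \<le> f (jump_time f j)"
    using jump_time_le_iff[OF assms(1)] jump_time_nonneg[OF assms(1)] by blast
  with assms(2) show ?thesis
    using jump_time_le_iff[OF reach_mono[OF assms]] jump_time_nonneg[OF assms(1)] by simp
qed

lemma path_eq_between_jumps:
  assumes "\<exists>s\<ge>0. i \<le> f s" "jump_time f i \<le> u" "f u < Suc i"
  shows "f u = i"
  using jump_time_le_iff[OF assms(1), of u] jump_time_nonneg[OF assms(1)] assms by simp

end

lemma (in counting_path) sum_gap: "(\<Sum>j<i. gap f j) = jump_time f i"
  by (simp add: sum_lessThan_telescope)

section \<open>The maximum of a telegraph path\<close>

text \<open>
  Legs are numbered from \<open>0\<close>, and a path that starts downwards goes down on the even ones.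
\<close>

definition leg_speed :: "real \<Rightarrow> real \<Rightarrow> nat \<Rightarrow> real" where
  "leg_speed c1 c2 i = (if even i then - c2 else c1)"

text \<open>
  The position at the start of leg \<open>i\<close>, given the durations \<open>e\<close> of the legs.
\<close>

definition turning_point :: "real \<Rightarrow> real \<Rightarrow> (nat \<Rightarrow> real) \<Rightarrow> nat \<Rightarrow> real" where
  "turning_point c1 c2 e i = (\<Sum>j<i. leg_speed c1 c2 j * e j)"

lemma switch_velocity_funpow:
  assumes "0 < c1" "0 < c2"
  shows "(switch_velocity c1 c2 ^^ i) (- c2) = leg_speed c1 c2 i"
  using assms by (induction i) (auto simp: leg_speed_def switch_velocity_def)

text \<open>
  Between consecutive jump times the velocity is constant, so each leg adds speed times duration. When jumps
  coincide, the leg between them has length zero and leaves the integral unchanged.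
\<close>

lemma (in counting_path) has_integral_leg_speed:
  assumes "\<exists>s\<ge>0. i \<le> f s" "jump_time f i \<le> s" "\<And>u. jump_time f i \<le> u \<Longrightarrow> u < s \<Longrightarrow> f u = i"
  shows "((\<lambda>u. leg_speed c1 c2 (f u)) has_integral
    turning_point c1 c2 (gap f) i + leg_speed c1 c2 i * (s - jump_time f i)) {0..s}"
  using assms
proof (induction i arbitrary: s)
  case 0
  have "((\<lambda>u. leg_speed c1 c2 0) has_integral leg_speed c1 c2 0 * s) {0..s}"
    using has_integral_const_real[of "leg_speed c1 c2 0" 0 s] 0 by (simp add: mult.commute)
  then have "((\<lambda>u. leg_speed c1 c2 (f u)) has_integral leg_speed c1 c2 0 * s) {0..s}"
    by (rule has_integral_spike[OF negligible_sing[of s], rotated]) (use 0 in auto)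
  then show ?case by (simp add: turning_point_def)
next
  case (Suc i)
  let ?J = "jump_time f (Suc i)"
  have ri: "\<exists>s\<ge>0. i \<le> f s" using Suc.prems(1) by (rule reach_mono) simp
  have J: "0 \<le> ?J" "jump_time f i \<le> ?J"
    using jump_time_nonneg[OF Suc.prems(1)] jump_time_mono[OF Suc.prems(1), of i] by auto
  have 1: "((\<lambda>u. leg_speed c1 c2 (f u)) has_integral turning_point c1 c2 (gap f) (Suc i)) {0..?J}"
  proof -
    have "f u = i" if "jump_time f i \<le> u" "u < ?J" for u
      by (rule path_eq_between_jumps[OF ri that(1)])
         (use that jump_time_le_iff[OF Suc.prems(1), of u] jump_time_nonneg[OF ri] in linarith)
    from Suc.IH[OF ri J(2) this] show ?thesis by (simp add: turning_point_def)
  qed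
  have "((\<lambda>u. leg_speed c1 c2 (Suc i)) has_integral leg_speed c1 c2 (Suc i) * (s - ?J)) {?J..s}"
    using has_integral_const_real[of "leg_speed c1 c2 (Suc i)" ?J s] Suc.prems(2) by (simp add: mult.commute)
  then have 2: "((\<lambda>u. leg_speed c1 c2 (f u)) has_integral leg_speed c1 c2 (Suc i) * (s - ?J)) {?J..s}"
    by (rule has_integral_spike[OF negligible_sing[of s], rotated]) (use Suc.prems(3) in auto)
  show ?case by (rule has_integral_combine[OF J(1) Suc.prems(2) 1 2])
qed

text \<open>
  On a downward leg the path lies below the start of the leg, on an upward one below its end. The
  last leg is downward because the number of events is even; so the nodes up to time \<open>t\<close> dominate the path.
\<close>

lemma running_max_le_iff:
  assumes "0 < c1" "0 < c2" "0 \<le> \<beta>" "0 \<le> t" "counting_path (\<lambda>s. N s \<omega>)" "V0 \<omega> = - c2" "N t \<omega> = 2 * k"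
  shows "running_max (telegraph c1 c2 V0 N) t \<omega> \<le> \<beta> \<longleftrightarrow>
    (\<forall>j\<le>2 * k. turning_point c1 c2 (gap (\<lambda>s. N s \<omega>)) j \<le> \<beta>)"
proof -
  define f where "f = (\<lambda>s. N s \<omega>)"
  interpret counting_path f unfolding f_def by fact
  define T where "T = (\<lambda>s. telegraph c1 c2 V0 N s \<omega>)"
  define P where "P = turning_point c1 c2 (gap f)"
  have ft: "f t = 2 * k" using assms(7) by (simp add: f_def)
  have reach: "\<exists>s\<ge>0. j \<le> f s" if "j \<le> 2 * k" for j using that ft assms(4) by auto
  have T: "T s = P i + leg_speed c1 c2 i * (s - jump_time f i)"
    if "\<exists>s\<ge>0. i \<le> f s" "jump_time f i \<le> s" "\<And>u. jump_time f i \<le> u \<Longrightarrow> u < s \<Longrightarrow> f u = i" for i s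
    using has_integral_leg_speed[OF that, of c1 c2] switch_velocity_funpow[OF assms(1,2)] assms(6)
    unfolding T_def P_def telegraph_def velocity_def by (simp add: integral_unique f_def)
  have node: "T (jump_time f j) = P j" if "j \<le> 2 * k" for j
    using T[OF reach[OF that] order_refl] by simp
  have bound: "\<exists>j\<le>2 * k. T s \<le> P j" if s: "s \<in> {0..t}" for s
  proof -
    define i where "i = f s"
    have i: "i \<le> 2 * k" using path_le[of s t] s ft by (simp add: i_def)
    have Js: "jump_time f i \<le> s" using jump_time_le_iff[OF reach[OF i], of s] s by (simp add: i_def)
    have const: "f u = i" if "jump_time f i \<le> u" "u < s" for u
      by (rule path_eq_between_jumps[OF reach[OF i] that(1)])
         (use path_le[of u s] that jump_time_nonneg[OF reach[OF i]] in \<open>simp add: i_def\<close>)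
    have Ts: "T s = P i + leg_speed c1 c2 i * (s - jump_time f i)"
      by (rule T[OF reach[OF i] Js const])
    show ?thesis
    proof (cases "even i")
      case True
      then have "T s \<le> P i" using Ts Js assms(2) by (simp add: leg_speed_def)
      with i show ?thesis by blast
    next
      case False
      then have i': "Suc i \<le> 2 * k" using i by (cases "i = 2 * k") auto
      have "s < jump_time f (Suc i)"
        using jump_time_le_iff[OF reach[OF i'], of s] s by (simp add: i_def not_le[symmetric])
      then have "c1 * (s - jump_time f i) \<le> c1 * gap f i" using assms(1) by simp
      then have "T s \<le> P (Suc i)"
        using Ts False by (simp add: P_def turning_point_def leg_speed_def)
      with i' show ?thesis by blast
    qed
  qed
  have bdd: "bdd_above (T ` {0..t})"
  proof (rule bdd_aboveI2)
    fix s assume "s \<in> {0..t}"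
    from bound[OF this] obtain j where "j \<le> 2 * k" "T s \<le> P j" by blast
    then show "T s \<le> Max (P ` {..2 * k})" by (meson Max_ge atMost_iff finite_atMost finite_imageI imageI order_trans)
  qed
  have "(SUP s\<in>{0..t}. T s) \<le> \<beta> \<longleftrightarrow> (\<forall>s\<in>{0..t}. T s \<le> \<beta>)"
    by (rule cSUP_le_iff) (use bdd assms(4) in auto)
  also have "\<dots> \<longleftrightarrow> (\<forall>j\<le>2 * k. P j \<le> \<beta>)"
  proof safe
    fix j assume *: "\<forall>s\<in>{0..t}. T s \<le> \<beta>" "j \<le> 2 * k"
    have "jump_time f j \<in> {0..t}"
      using jump_time_le_iff[OF reach[OF *(2)], of t] jump_time_nonneg[OF reach[OF *(2)]] *(2) ft assms(4) by simp
    with *(1) have "T (jump_time f j) \<le> \<beta>" by blast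
    then show "P j \<le> \<beta>" by (simp add: node[OF *(2)])
  next
    fix s assume "\<forall>j\<le>2 * k. P j \<le> \<beta>" "s \<in> {0..t}"
    with bound show "T s \<le> \<beta>" by (meson order_trans)
  qed
  finally show ?thesis by (simp add: running_max_def T_def P_def f_def)
qed

section \<open>Waiting times of a Poisson process\<close>

text \<open>
  The \<open>\<sigma>\<close>-algebra is arbitrary because the lemma is used twice: for the whole probability space, and for
  the \<open>\<sigma>\<close>-algebra of the counting process, from which the initial velocity is independent.
\<close>

lemma jump_time_measurable:
  fixes f :: "'a \<Rightarrow> real \<Rightarrow> nat"
  assumes [measurable]: "\<And>s. 0 \<le> s \<Longrightarrow> (\<lambda>\<omega>. f \<omega> s) \<in> measurable A (count_space UNIV)"
    and path: "\<And>\<omega>. \<omega> \<in> space A \<Longrightarrow> counting_path (f \<omega>)"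
  shows "(\<lambda>\<omega>. jump_time (f \<omega>) j) \<in> borel_measurable A"
  unfolding borel_measurable_iff_le
proof
  fix a :: real
  let ?R = "{\<omega>\<in>space A. \<exists>m::nat. j \<le> f \<omega> (real m)}"
  have [measurable]: "?R \<in> sets A" "{\<omega>\<in>space A. j \<le> f \<omega> (max 0 a)} \<in> sets A"
    by measurable
  have reach: "(\<exists>s\<ge>0. j \<le> f \<omega> s) \<longleftrightarrow> (\<exists>m::nat. j \<le> f \<omega> (real m))" if "\<omega> \<in> space A" for \<omega>
  proof
    interpret counting_path "f \<omega>" by (rule path[OF that])
    assume "\<exists>s\<ge>0. j \<le> f \<omega> s"
    then obtain s where s: "0 \<le> s" "j \<le> f \<omega> s" by blast
    obtain m :: nat where "s \<le> real m" using real_arch_simple by blast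
    with s path_le[of s "real m"] show "\<exists>m::nat. j \<le> f \<omega> (real m)" by (meson order_trans)
  qed (meson of_nat_0_le_iff)
  \<comment> \<open>On the paths that never reach \<open>j\<close> the jump time is the constant \<open>Inf {}\<close>.\<close>
  have "{\<omega>\<in>space A. jump_time (f \<omega>) j \<le> a} =
     (if 0 \<le> a then ?R \<inter> {\<omega>\<in>space A. j \<le> f \<omega> (max 0 a)} else {})
     \<union> (if Inf {} \<le> a then space A - ?R else {})"
  proof (rule set_eqI)
    fix \<omega>
    show "\<omega> \<in> {\<omega>\<in>space A. jump_time (f \<omega>) j \<le> a} \<longleftrightarrow> \<omega> \<in> (if 0 \<le> a then ?R \<inter> {\<omega>\<in>space A. j \<le> f \<omega> (max 0 a)} else {})
     \<union> (if Inf {} \<le> a then space A - ?R else {})"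
    proof (cases "\<omega> \<in> ?R")
      case True
      then have \<omega>: "\<omega> \<in> space A" "\<exists>s\<ge>0. j \<le> f \<omega> s" using reach by auto
      interpret counting_path "f \<omega>" by (rule path[OF \<omega>(1)])
      show ?thesis
        using True \<omega>(1) jump_time_le_iff[OF \<omega>(2), of a] jump_time_nonneg[OF \<omega>(2)] by auto
    next
      case False
      have "jump_time (f \<omega>) j = Inf {}" if "\<omega> \<in> space A"
      proof -
        have "{s. 0 \<le> s \<and> j \<le> f \<omega> s} = {}" using False reach[OF that] that by blast
        then show ?thesis by (simp only: jump_time_def)
      qed
      with False show ?thesis by auto
    qed
  qed
  also have "\<dots> \<in> sets A" by auto
  finally show "{\<omega>\<in>space A. jump_time (f \<omega>) j \<le> a} \<in> sets A" .
qed

context poisson_process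
begin

lemma path: "\<omega> \<in> space M \<Longrightarrow> counting_path (\<lambda>s. N s \<omega>)"
  by unfold_locales (auto simp: count_mono count_right_continuous count_zero)

lemma N_le: "\<omega> \<in> space M \<Longrightarrow> 0 \<le> s \<Longrightarrow> s \<le> u \<Longrightarrow> N s \<omega> \<le> N u \<omega>"
  by (rule counting_path.path_le[OF path])

definition J :: "nat \<Rightarrow> 'a \<Rightarrow> real" where
  "J j \<omega> = jump_time (\<lambda>s. N s \<omega>) j"

definition waiting_time :: "nat \<Rightarrow> 'a \<Rightarrow> real" where
  "waiting_time j \<omega> = gap (\<lambda>s. N s \<omega>) j"

lemma waiting_time_eq: "waiting_time j \<omega> = J (Suc j) \<omega> - J j \<omega>"
  by (simp add: waiting_time_def J_def)

lemmas N_measurable [measurable] = count_measurable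

lemma J_measurable [measurable]: "J j \<in> borel_measurable M"
  unfolding J_def by (rule jump_time_measurable) (auto simp: path)

lemma waiting_time_measurable [measurable]: "waiting_time j \<in> borel_measurable M"
  unfolding waiting_time_eq[abs_def] by measurable

lemma prob_increment:
  assumes "0 \<le> s" "0 < r"
  shows "prob {\<omega>\<in>space M. N (s + r) \<omega> - N s \<omega> \<in> A} = measure (poisson_pmf (rate * r)) A"
proof -
  have [measurable]: "N s \<in> measurable M (count_space UNIV)" "N (s + r) \<in> measurable M (count_space UNIV)"
    using assms by (auto intro: count_measurable)
  have "measure (distr M (count_space UNIV) (\<lambda>\<omega>. N (s + r) \<omega> - N s \<omega>)) A
      = prob ((\<lambda>\<omega>. N (s + r) \<omega> - N s \<omega>) -` A \<inter> space M)"
    by (rule measure_distr) auto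
  also have "(\<lambda>\<omega>. N (s + r) \<omega> - N s \<omega>) -` A \<inter> space M = {\<omega>\<in>space M. N (s + r) \<omega> - N s \<omega> \<in> A}" by auto
  finally show ?thesis using poisson_increments[of s "s + r"] assms by simp
qed

lemma prob_no_increment:
  assumes "0 \<le> s" "0 < r"
  shows "prob {\<omega>\<in>space M. N (s + r) \<omega> - N s \<omega> = 0} = exp (- rate * r)"
  using prob_increment[OF assms, of "{0}"] rate_pos assms by (simp add: measure_pmf_single)

lemma prob_two_increments_le:
  assumes "0 \<le> s" "0 < r"
  shows "prob {\<omega>\<in>space M. 2 \<le> N (s + r) \<omega> - N s \<omega>} \<le> (rate * r)\<^sup>2"
proof -
  let ?x = "rate * r"
  have x: "0 < ?x" using assms rate_pos by simp
  have "{2..} = - {0, 1::nat}" by (auto simp: not_le)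
  then have "measure (poisson_pmf ?x) {2..} = 1 - measure (poisson_pmf ?x) {0, 1}"
    using measure_pmf.prob_compl[of "{0,1}" "poisson_pmf ?x"] by (simp add: Compl_eq_Diff_UNIV)
  also have "measure (poisson_pmf ?x) {0, 1} = (1 + ?x) * exp (- ?x)"
    using x by (simp add: measure_measure_pmf_finite algebra_simps)
  also have "1 - (1 + ?x) * exp (- ?x) \<le> 1 - (1 + ?x) * (1 - ?x)"
    using exp_ge_add_one_self[of "- ?x"] x by (intro diff_left_mono mult_left_mono) auto
  also have "\<dots> = ?x\<^sup>2" by (simp add: power2_eq_square algebra_simps)
  finally show ?thesis using prob_increment[OF assms, of "{2..}"] by simp
qed

text \<open>
  Finitely many conditions on the counts up to time \<open>u\<close>: an intersection-stable generator of the past.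
\<close>

definition cylinders :: "real \<Rightarrow> 'a set set" where
  "cylinders u = {C. \<exists>U S. finite U \<and> U \<subseteq> {0..u} \<and> C = {\<omega>\<in>space M. \<forall>s\<in>U. N s \<omega> \<in> S s}}"

definition past :: "real \<Rightarrow> 'a measure" where
  "past u = sigma (space M) (cylinders u)"

lemma cylinders_Pow: "cylinders u \<subseteq> Pow (space M)"
  by (auto simp: cylinders_def)

lemma space_past [simp]: "space (past u) = space M"
  by (simp add: past_def cylinders_Pow space_measure_of)

lemma sets_past: "sets (past u) = sigma_sets (space M) (cylinders u)"
  by (simp add: past_def cylinders_Pow)

lemma N_measurable_past:
  assumes "0 \<le> s" "s \<le> u"
  shows "N s \<in> measurable (past u) (count_space UNIV)"
proof (rule measurableI)
  fix A :: "nat set"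
  have "N s -` A \<inter> space (past u) = {\<omega>\<in>space M. \<forall>s\<in>{s}. N s \<omega> \<in> (\<lambda>_. A) s}" by auto
  also have "\<dots> \<in> cylinders u"
    unfolding cylinders_def using assms
    by (intro CollectI exI[of _ "{s}"] exI[of _ "\<lambda>_. A"]) auto
  finally show "N s -` A \<inter> space (past u) \<in> sets (past u)" by (simp add: sets_past sigma_sets.Basic)
qed simp

lemma Int_stable_cylinders: "Int_stable (cylinders u)"
proof (rule Int_stableI)
  fix A B assume "A \<in> cylinders u" "B \<in> cylinders u"
  then obtain U S V T where U: "finite U" "U \<subseteq> {0..u}" "A = {\<omega>\<in>space M. \<forall>s\<in>U. N s \<omega> \<in> S s}"
    and V: "finite V" "V \<subseteq> {0..u}" "B = {\<omega>\<in>space M. \<forall>s\<in>V. N s \<omega> \<in> T s}"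
    by (auto simp: cylinders_def)
  let ?R = "\<lambda>s. (if s \<in> U then S s else UNIV) \<inter> (if s \<in> V then T s else UNIV)"
  have "A \<inter> B = {\<omega>\<in>space M. \<forall>s\<in>U \<union> V. N s \<omega> \<in> ?R s}"
    unfolding U V by auto
  then show "A \<inter> B \<in> cylinders u"
    unfolding cylinders_def using U V
    by (intro CollectI exI[of _ "U \<union> V"] exI[of _ ?R]) auto
qed

lemma cylinders_events: "cylinders u \<subseteq> events"
proof
  fix C assume "C \<in> cylinders u"
  then obtain U S where "finite U" "U \<subseteq> {0..u}" "C = {\<omega>\<in>space M. \<forall>s\<in>U. N s \<omega> \<in> S s}"
    by (auto simp: cylinders_def)
  moreover have "{\<omega>\<in>space M. N s \<omega> \<in> S s} \<in> events" if "s \<in> U" for s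
  proof -
    have "0 \<le> s" using \<open>U \<subseteq> {0..u}\<close> that by auto
    from measurable_sets[OF count_measurable[OF this], of "S s"]
    show ?thesis by (simp add: vimage_def Int_def conj_commute)
  qed
  ultimately show "C \<in> events" by (auto intro!: sets.sets_Collect_finite_All)
qed

lemma past_events: "sets (past u) \<subseteq> events"
  unfolding sets_past by (rule sets.sigma_sets_subset[OF cylinders_events])

text \<open>
  Add \<open>0\<close> and \<open>u\<close> to the finitely many times, sort them, and append \<open>u + r\<close>. The counts at the listed times
  are partial sums of the increments between neighbours, and the last increment is independent of these.
\<close>

lemma cylinder_indep_increment:
  assumes u: "0 \<le> u" and r: "0 < r" and U: "finite U" "U \<subseteq> {0..u}"
  shows "prob ({\<omega>\<in>space M. \<forall>s\<in>U. N s \<omega> \<in> S s} \<inter> {\<omega>\<in>space M. N (u + r) \<omega> - N u \<omega> \<in> A})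
    = prob {\<omega>\<in>space M. \<forall>s\<in>U. N s \<omega> \<in> S s} * prob {\<omega>\<in>space M. N (u + r) \<omega> - N u \<omega> \<in> A}"
proof -
  define V where "V = insert 0 (insert u U)"
  define L where "L = sorted_list_of_set V"
  define n where "n = length L - 1"
  have "finite V" using U by (simp add: V_def)
  then have "set L = V" and strict: "sorted_wrt (<) L" unfolding L_def by simp_all
  then have setL: "set L = insert 0 (insert u U)" by (simp add: V_def)
  have len: "length L = Suc n" using setL by (cases L) (auto simp: n_def)
  have less: "L ! i < L ! j" if "i < j" "j \<le> n" for i j
    using strict that len by (simp add: sorted_wrt_nth_less)
  have range: "L ! i \<in> {0..u}" if "i \<le> n" for i
  proof -
    have "L ! i \<in> set L" using that len by simp
    then show ?thesis unfolding setL using U u by auto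
  qed
  have L0: "L ! 0 = 0"
  proof -
    obtain i where i: "i \<le> n" "L ! i = 0" using setL len by (metis in_set_conv_nth insertI1 less_Suc_eq_le)
    then show ?thesis using less[of 0 i] range[of 0] by (cases "i = 0") auto
  qed
  have Ln: "L ! n = u"
  proof -
    obtain i where i: "i \<le> n" "L ! i = u" using setL len by (metis in_set_conv_nth insertI1 insertI2 less_Suc_eq_le)
    then show ?thesis using less[of i n] range[of n] by (cases "i = n") auto
  qed
  define \<tau> where "\<tau> i = (if i \<le> n then L ! i else u + r)" for i
  have mono: "strict_mono_on {..Suc n} \<tau>"
  proof (rule strict_mono_onI)
    fix i j assume "i \<in> {..Suc n}" "j \<in> {..Suc n}" "i < j"
    then show "\<tau> i < \<tau> j" using less[of i j] range[of i] r by (auto simp: \<tau>_def)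
  qed
  define D where "D i \<omega> = N (\<tau> (Suc i)) \<omega> - N (\<tau> i) \<omega>" for i \<omega>
  have "indep_vars (\<lambda>_. count_space UNIV) D {..<Suc n}"
    unfolding D_def[abs_def] by (rule independent_increments[OF _ mono]) (simp add: \<tau>_def L0)
  then have indep: "indep_var (PiM {..<n} (\<lambda>_. count_space UNIV)) (\<lambda>\<omega>. \<lambda>i\<in>{..<n}. D i \<omega>)
      (PiM {n} (\<lambda>_. count_space UNIV)) (\<lambda>\<omega>. \<lambda>i\<in>{n}. D i \<omega>)"
    by (rule indep_var_restrict) auto
  have NL: "N (L ! i) \<omega> = (\<Sum>j<i. D j \<omega>)" if \<omega>: "\<omega> \<in> space M" and i: "i \<le> n" for i \<omega>
    using i
  proof (induction i)
    case 0
    then show ?case by (simp add: L0 count_zero[OF \<omega>])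
  next
    case (Suc i)
    have "N (L ! i) \<omega> \<le> N (L ! Suc i) \<omega>"
      using range[of i] less[of i "Suc i"] Suc.prems by (intro N_le[OF \<omega>]) auto
    with Suc show ?case by (simp add: D_def \<tau>_def)
  qed
  let ?X = "{g \<in> {..<n} \<rightarrow>\<^sub>E (UNIV :: nat set). \<forall>i\<le>n. L ! i \<in> U \<longrightarrow> (\<Sum>j<i. g j) \<in> S (L ! i)}"
  let ?Y = "{g \<in> {n} \<rightarrow>\<^sub>E (UNIV :: nat set). g n \<in> A}"
  have sets: "?X \<in> sets (PiM {..<n} (\<lambda>_. count_space UNIV))" "?Y \<in> sets (PiM {n} (\<lambda>_. count_space UNIV))"
    by (auto simp: count_space_PiM_finite)
  have X: "(\<lambda>\<omega>. \<lambda>i\<in>{..<n}. D i \<omega>) -` ?X \<inter> space M = {\<omega>\<in>space M. \<forall>s\<in>U. N s \<omega> \<in> S s}"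
  proof -
    have "(\<forall>i\<le>n. L ! i \<in> U \<longrightarrow> (\<Sum>j<i. (\<lambda>i\<in>{..<n}. D i \<omega>) j) \<in> S (L ! i)) \<longleftrightarrow> (\<forall>s\<in>U. N s \<omega> \<in> S s)"
      if \<omega>: "\<omega> \<in> space M" for \<omega>
    proof -
      have "(\<Sum>j<i. (\<lambda>i\<in>{..<n}. D i \<omega>) j) = N (L ! i) \<omega>" if "i \<le> n" for i
        unfolding NL[OF \<omega> that] by (rule sum.cong) (use that in auto)
      moreover have "(\<forall>s\<in>U. N s \<omega> \<in> S s) \<longleftrightarrow> (\<forall>i\<le>n. L ! i \<in> U \<longrightarrow> N (L ! i) \<omega> \<in> S (L ! i))"
      proof -
        have "\<exists>i\<le>n. L ! i = s" if "s \<in> U" for s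
          using that setL len by (metis in_set_conv_nth insertI2 less_Suc_eq_le)
        then show ?thesis by metis
      qed
      ultimately show ?thesis by auto
    qed
    then show ?thesis by auto
  qed
  have Y: "(\<lambda>\<omega>. \<lambda>i\<in>{n}. D i \<omega>) -` ?Y \<inter> space M = {\<omega>\<in>space M. N (u + r) \<omega> - N u \<omega> \<in> A}"
    by (auto simp: D_def \<tau>_def Ln)
  have "(\<lambda>\<omega>. (\<lambda>i\<in>{..<n}. D i \<omega>, \<lambda>i\<in>{n}. D i \<omega>)) -` (?X \<times> ?Y) \<inter> space M
      = {\<omega>\<in>space M. \<forall>s\<in>U. N s \<omega> \<in> S s} \<inter> {\<omega>\<in>space M. N (u + r) \<omega> - N u \<omega> \<in> A}"
    unfolding X[symmetric] Y[symmetric] by auto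
  with indep_varD[OF indep sets] show ?thesis unfolding X Y by simp
qed

lemma past_indep_increment:
  assumes u: "0 \<le> u" and r: "0 < r" and B: "B \<in> sets (past u)"
  shows "prob (B \<inter> {\<omega>\<in>space M. N (u + r) \<omega> - N u \<omega> \<in> A})
    = prob B * prob {\<omega>\<in>space M. N (u + r) \<omega> - N u \<omega> \<in> A}"
proof -
  let ?I = "\<lambda>A. {\<omega>\<in>space M. N (u + r) \<omega> - N u \<omega> \<in> A}"
  have [measurable]: "N u \<in> measurable M (count_space UNIV)" "N (u + r) \<in> measurable M (count_space UNIV)"
    using u r by (auto intro: count_measurable)
  have "indep_set (sigma_sets (space M) (cylinders u)) (sigma_sets (space M) (range ?I))"
  proof (rule indep_set_sigma_sets)
    show "indep_set (cylinders u) (range ?I)"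
    proof (rule indep_setI[OF cylinders_events])
      show "range ?I \<subseteq> events" by auto
      fix a b assume "a \<in> cylinders u" "b \<in> range ?I"
      then show "prob (a \<inter> b) = prob a * prob b"
        using cylinder_indep_increment[OF u r] by (auto simp: cylinders_def)
    qed
    show "Int_stable (range ?I)"
    proof (rule Int_stableI)
      fix a b assume "a \<in> range ?I" "b \<in> range ?I"
      then obtain A B where "a = ?I A" "b = ?I B" by auto
      then have "a \<inter> b = ?I (A \<inter> B)" by auto
      then show "a \<inter> b \<in> range ?I" by blast
    qed
  qed (rule Int_stable_cylinders)
  then show ?thesis
    by (rule indep_setD) (use B in \<open>auto simp: sets_past\<close>)
qed

lemma AE_unbounded: "AE \<omega> in M. \<forall>j. \<exists>s\<ge>0. j \<le> N s \<omega>"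
proof -
  have "AE \<omega> in M. \<exists>m::nat. j \<le> N (real m) \<omega>" for j
  proof -
    let ?E = "\<lambda>m. {\<omega>\<in>space M. N (real m) \<omega> < j}"
    have "(\<lambda>m. prob (?E (Suc m))) \<longlonglongrightarrow> 0"
    proof -
      have eq: "prob (?E (Suc m)) = (\<Sum>i<j. (1 / fact i) * ((rate * real (Suc m)) ^ i / exp (rate * real (Suc m))))" for m
      proof -
        have x: "0 < rate * real (Suc m)" using rate_pos by simp
        have "?E (Suc m) = {\<omega>\<in>space M. N (0 + real (Suc m)) \<omega> - N 0 \<omega> \<in> {..<j}}"
          by (auto simp: count_zero)
        then have "prob (?E (Suc m)) = measure (poisson_pmf (rate * real (Suc m))) {..<j}"
          using prob_increment[of 0 "real (Suc m)" "{..<j}"] by simp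
        also have "\<dots> = (\<Sum>i<j. pmf (poisson_pmf (rate * real (Suc m))) i)"
          by (simp add: measure_measure_pmf_finite)
        also have "\<dots> = (\<Sum>i<j. (1 / fact i) * ((rate * real (Suc m)) ^ i / exp (rate * real (Suc m))))"
          unfolding pmf_poisson[OF x] exp_minus by (simp add: field_simps)
        finally show ?thesis .
      qed
      \<comment> \<open>Each of the finitely many Poisson probabilities tends to \<open>0\<close> as its mean grows.\<close>
      have "filterlim (\<lambda>m. rate * real (Suc m)) at_top sequentially"
        by (intro filterlim_tendsto_pos_mult_at_top[OF tendsto_const rate_pos]
            filterlim_compose[OF filterlim_real_sequentially filterlim_Suc])
      then have "(\<lambda>m. \<Sum>i<j. (1 / fact i) * ((rate * real (Suc m)) ^ i / exp (rate * real (Suc m))))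
         \<longlonglongrightarrow> (\<Sum>i<j. (1 / fact i) * 0)"
        by (intro tendsto_intros filterlim_compose[OF tendsto_power_div_exp_0])
      then show ?thesis unfolding eq by simp
    qed
    moreover have "prob {\<omega>\<in>space M. \<forall>m::nat. N (real m) \<omega> < j} \<le> prob (?E (Suc m))" for m
      by (rule finite_measure_mono) (blast, measurable)
    ultimately have "prob {\<omega>\<in>space M. \<forall>m::nat. N (real m) \<omega> < j} \<le> 0"
      by (intro LIMSEQ_le_const) auto
    then have "prob {\<omega>\<in>space M. \<not> (\<exists>m::nat. j \<le> N (real m) \<omega>)} = 0"
      using measure_nonneg[of M] by (simp add: not_le antisym)
    then show ?thesis by (subst AE_iff_measurable[OF _ refl]) (auto simp: emeasure_eq_measure)
  qed
  then have "AE \<omega> in M. \<forall>j. \<exists>m::nat. j \<le> N (real m) \<omega>" by (subst AE_all_countable) auto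
  then show ?thesis by eventually_elim (meson of_nat_0_le_iff)
qed

text \<open>
  If an event time before \<open>T\<close> had multiplicity two, then on every grid of width \<open>h\<close> some cell would carry an
  increment of at least two. There are \<open>T / h\<close> cells, and each has this property with probability at most
  \<open>(rate * h)\<^sup>2\<close>, so the total vanishes as \<open>h\<close> tends to \<open>0\<close>.
\<close>

lemma AE_simple_jumps: "AE \<omega> in M. \<forall>j. N (J j \<omega>) \<omega> = j"
proof -
  let ?h = "\<lambda>m. 1 / real (Suc m)"
  let ?I = "\<lambda>m q. {\<omega>\<in>space M. 2 \<le> N (real q * ?h m + ?h m) \<omega> - N (real q * ?h m) \<omega>}"
  let ?D = "\<lambda>T m. \<Union>q<T * Suc m. ?I m q"
  have [measurable]: "?I m q \<in> events" for m q by measurable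
  have bound: "prob (?D T m) \<le> real T * rate\<^sup>2 * ?h m" for T m
  proof -
    have "prob (?D T m) \<le> (\<Sum>q<T * Suc m. prob (?I m q))"
      by (rule finite_measure_subadditive_finite) auto
    also have "\<dots> \<le> (\<Sum>q<T * Suc m. (rate * ?h m)\<^sup>2)"
      by (intro sum_mono prob_two_increments_le) auto
    also have "\<dots> = real T * real (Suc m) * (rate * ?h m)\<^sup>2"
      by (simp only: sum_constant card_lessThan of_nat_mult)
    also have "\<dots> = real T * rate\<^sup>2 * ?h m"
      by (simp add: power2_eq_square field_simps del: of_nat_Suc)
    finally show ?thesis .
  qed
  have "AE \<omega> in M. \<exists>m. \<omega> \<notin> ?D T m" for T
  proof -
    have "(\<lambda>m. real T * rate\<^sup>2 * ?h m) \<longlonglongrightarrow> real T * rate\<^sup>2 * 0"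
      by (intro tendsto_intros LIMSEQ_Suc lim_1_over_n)
    moreover have "prob (\<Inter>m. ?D T m) \<le> real T * rate\<^sup>2 * ?h m" for m
      by (rule order_trans[OF finite_measure_mono bound]) auto
    ultimately have "prob (\<Inter>m. ?D T m) \<le> 0"
      by (intro LIMSEQ_le_const) auto
    then have "prob (\<Inter>m. ?D T m) = 0" using measure_nonneg[of M] by (simp add: antisym)
    moreover have "{\<omega>\<in>space M. \<not> (\<exists>m. \<omega> \<notin> ?D T m)} = (\<Inter>m. ?D T m)" by auto
    ultimately show ?thesis
      by (subst AE_iff_measurable[OF _ refl]) (auto simp: emeasure_eq_measure)
  qed
  then have "AE \<omega> in M. \<forall>T. \<exists>m. \<omega> \<notin> ?D T m" by (subst AE_all_countable) auto
  with AE_unbounded AE_space show ?thesis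
  proof eventually_elim
    fix \<omega> assume reach: "\<forall>j. \<exists>s\<ge>0. j \<le> N s \<omega>" and \<omega>: "\<omega> \<in> space M" and D: "\<forall>T. \<exists>m. \<omega> \<notin> ?D T m"
    interpret counting_path "\<lambda>s. N s \<omega>" by (rule path[OF \<omega>])
    have le_iff: "J j \<omega> \<le> u \<longleftrightarrow> j \<le> N u \<omega>" if "0 \<le> u" for j u
      unfolding J_def using jump_time_le_iff reach that by blast
    have J0: "0 \<le> J j \<omega>" for j unfolding J_def using jump_time_nonneg reach by blast
    show "\<forall>j. N (J j \<omega>) \<omega> = j"
    proof (rule allI, rule ccontr)
      fix j assume neq: "N (J j \<omega>) \<omega> \<noteq> j"
      have "j \<le> N (J j \<omega>) \<omega>" using le_iff[OF J0] by blast
      with neq have big: "Suc j \<le> N (J j \<omega>) \<omega>" by simp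
      have pos: "0 < J j \<omega>" using J0[of j] big path_zero by (cases "J j \<omega> = 0") auto
      obtain T :: nat where T: "J j \<omega> \<le> real T" using real_arch_simple by blast
      obtain m where m: "\<omega> \<notin> ?D T m" using D by blast
      \<comment> \<open>The cell \<open>(q h, (q + 1) h]\<close> that contains the jump.\<close>
      define q where "q = nat \<lceil>J j \<omega> * real (Suc m)\<rceil> - 1"
      have "0 < J j \<omega> * real (Suc m)" using pos by simp
      then have ceil: "1 \<le> \<lceil>J j \<omega> * real (Suc m)\<rceil>" by (simp add: one_le_ceiling)
      then have rq: "real q = of_int \<lceil>J j \<omega> * real (Suc m)\<rceil> - 1"
        by (simp add: q_def of_nat_diff nat_le_iff le_nat_iff)
      have q1: "real q < J j \<omega> * real (Suc m)" "J j \<omega> * real (Suc m) \<le> real q + 1"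
        unfolding rq by linarith+
      have "J j \<omega> * real (Suc m) \<le> real T * real (Suc m)" using T by (intro mult_right_mono) auto
      then have "real q < real (T * Suc m)" using q1(1) unfolding of_nat_mult by linarith
      then have qT: "q < T * Suc m" by (simp only: of_nat_less_iff)
      have lo: "real q * ?h m < J j \<omega>" and hi: "J j \<omega> \<le> real q * ?h m + ?h m"
        using q1 by (simp_all add: field_simps del: of_nat_Suc)
      have "N (real q * ?h m) \<omega> < j" using le_iff[of "real q * ?h m" j] lo by simp
      moreover have "Suc j \<le> N (real q * ?h m + ?h m) \<omega>"
        using big path_le[OF J0 hi] by simp
      ultimately have "\<omega> \<in> ?I m q" using \<omega> by simp
      with m qT show False by blast
    qed
  qed
qed

text \<open>
  An instance of the strong Markov property. The assumption on \<open>B\<close> says that \<open>B\<close> is determined by what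
  happens up to the \<open>i\<close>-th event. Round that event time up to the grid of width \<open>h\<close>. On each of
  the disjoint events "the rounded time is \<open>q h\<close>", which belong to the past of \<open>q h\<close>, the absence of
  events in the next \<open>r\<close> time units is independent and has probability \<open>exp (- rate * r)\<close>. As \<open>h\<close>
  tends to \<open>0\<close>, right continuity at \<open>J i\<close> and at \<open>J i + r\<close> shows that for almost every path the two events
  "no event in the next \<open>r\<close> units after the rounded time" and "the waiting time exceeds \<open>r\<close>" eventually
  agree.
\<close>

lemma waiting_time_after:
  assumes B: "B \<in> events" and BN: "\<And>u. 0 \<le> u \<Longrightarrow> B \<inter> {\<omega>\<in>space M. i \<le> N u \<omega>} \<in> sets (past u)"
    and r: "0 < r"
  shows "prob (B \<inter> {\<omega>\<in>space M. r < waiting_time i \<omega>}) = prob B * exp (- rate * r)"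
proof -
  define h where "h m = 1 / real (Suc m)" for m
  have h: "0 < h m" for m by (simp add: h_def)
  define g where "g m q = real q * h m" for m q
  have g0: "0 \<le> g m q" for m q using h[of m] by (simp add: g_def)
  \<comment> \<open>\<open>C m q\<close> says that \<open>q h\<close> is the first grid point at or after the event time \<open>J i\<close>, hence lies within \<open>h\<close> of it.\<close>
  define C where "C m q = B \<inter> {\<omega>\<in>space M. i \<le> N (g m q) \<omega>} \<inter> {\<omega>\<in>space M. q = 0 \<or> N (g m (q - 1)) \<omega> < i}" for m q
  define I where "I m q = {\<omega>\<in>space M. N (g m q + r) \<omega> - N (g m q) \<omega> \<in> {0}}" for m q
  define E where "E m = (\<Union>q. C m q \<inter> I m q)" for m
  have gmono: "g m q \<le> g m q'" if "q \<le> q'" for m q q'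
    using h[of m] that by (simp add: g_def mult_right_mono)
  have C_past: "C m q \<in> sets (past (g m q))" for m q
  proof -
    have "{\<omega>\<in>space M. q = 0 \<or> N (g m (q - 1)) \<omega> < i} \<in> sets (past (g m q))"
    proof (cases "q = 0")
      case True
      then show ?thesis using sets.top[of "past (g m q)"] by simp
    next
      case False
      have "N (g m (q - 1)) -` {..<i} \<inter> space (past (g m q)) \<in> sets (past (g m q))"
        by (rule measurable_sets[OF N_measurable_past]) (auto simp: g0 intro: gmono)
      also have "N (g m (q - 1)) -` {..<i} \<inter> space (past (g m q)) = {\<omega>\<in>space M. q = 0 \<or> N (g m (q - 1)) \<omega> < i}"
        using False by auto
      finally show ?thesis .
    qed
    with BN[OF g0] show ?thesis unfolding C_def by (rule sets.Int)
  qed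
  then have C_ev: "C m q \<in> events" for m q using past_events by blast
  have I_ev: "I m q \<in> events" for m q
  proof -
    have [measurable]: "N (g m q) \<in> measurable M (count_space UNIV)" "N (g m q + r) \<in> measurable M (count_space UNIV)"
      using g0[of m q] r by (auto intro: count_measurable)
    show ?thesis unfolding I_def by measurable
  qed
  have disj: "disjoint_family (C m)" for m
  proof -
    have "C m q \<inter> C m q' = {}" if "q < q'" for q q'
    proof -
      have le: "q \<le> q' - 1" using \<open>q < q'\<close> by simp
      have "False" if "\<omega> \<in> C m q" "\<omega> \<in> C m q'" for \<omega>
        using that N_le[OF _ g0 gmono[OF le], of \<omega> m] \<open>q < q'\<close> by (auto simp: C_def)
      then show ?thesis by blast
    qed
    then show ?thesis unfolding disjoint_family_on_def by (metis Int_commute linorder_neq_iff)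
  qed
  have C_ex: "\<exists>q. \<omega> \<in> C m q" if "\<omega> \<in> B" "\<exists>s\<ge>0. i \<le> N s \<omega>" for \<omega> m
  proof -
    have \<omega>: "\<omega> \<in> space M" using that(1) sets.sets_into_space[OF B] by blast
    from that(2) obtain s where s: "0 \<le> s" "i \<le> N s \<omega>" by blast
    obtain q :: nat where "s / h m \<le> real q" using real_arch_simple by blast
    then have "s \<le> g m q" using h[of m] by (simp add: g_def field_simps)
    then have ex: "i \<le> N (g m q) \<omega>" using N_le[OF \<omega> s(1)] s(2) by (meson order_trans)
    define q0 where "q0 = (LEAST q. i \<le> N (g m q) \<omega>)"
    have "i \<le> N (g m q0) \<omega>" unfolding q0_def by (rule LeastI[of "\<lambda>q. i \<le> N (g m q) \<omega>", OF ex])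
    moreover have "N (g m (q0 - 1)) \<omega> < i" if "q0 \<noteq> 0"
      using not_less_Least[of "q0 - 1" "\<lambda>q. i \<le> N (g m q) \<omega>"] that by (simp add: q0_def not_le)
    ultimately have "\<omega> \<in> C m q0" using \<omega> \<open>\<omega> \<in> B\<close> by (auto simp: C_def)
    then show ?thesis by blast
  qed
  have E_ev: "E m \<in> events" for m using C_ev I_ev by (auto simp: E_def)
  have prob_E: "prob (E m) = prob B * exp (- rate * r)" for m
  proof -
    have "(\<lambda>q. prob (C m q \<inter> I m q)) sums prob (E m)"
      unfolding E_def
    proof (rule finite_measure_UNION)
      show "range (\<lambda>q. C m q \<inter> I m q) \<subseteq> events" using C_ev I_ev by auto
      show "disjoint_family (\<lambda>q. C m q \<inter> I m q)"
        by (rule disjoint_family_on_bisimulation[OF disj[of m]]) blast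
    qed
    moreover have "prob (C m q \<inter> I m q) = prob (C m q) * exp (- rate * r)" for q
    proof -
      have "prob (C m q \<inter> I m q) = prob (C m q) * prob (I m q)"
        unfolding I_def by (rule past_indep_increment[OF g0 r C_past])
      also have "prob (I m q) = exp (- rate * r)"
        using prob_no_increment[OF g0 r, of m q] by (simp add: I_def)
      finally show ?thesis .
    qed
    ultimately have "(\<lambda>q. prob (C m q) * exp (- rate * r)) sums prob (E m)" by simp
    moreover have "(\<lambda>q. prob (C m q) * exp (- rate * r)) sums (prob (\<Union>q. C m q) * exp (- rate * r))"
      by (intro sums_mult2 finite_measure_UNION) (use C_ev disj in auto)
    moreover have "prob (\<Union>q. C m q) = prob B"
    proof (rule finite_measure_eq_AE)
      show "AE \<omega> in M. \<omega> \<in> (\<Union>q. C m q) \<longleftrightarrow> \<omega> \<in> B"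
        using AE_unbounded
      proof eventually_elim
        fix \<omega> assume reach: "\<forall>j. \<exists>s\<ge>0. j \<le> N s \<omega>"
        show "\<omega> \<in> (\<Union>q. C m q) \<longleftrightarrow> \<omega> \<in> B"
        proof
          assume "\<omega> \<in> B"
          from C_ex[OF this reach[rule_format], of m] show "\<omega> \<in> (\<Union>q. C m q)" by simp
        qed (auto simp: C_def)
      qed
    qed (use C_ev B in auto)
    ultimately show ?thesis using sums_unique2 by metis
  qed
  let ?G = "B \<inter> {\<omega>\<in>space M. r < waiting_time i \<omega>}"
  have G_ev: "?G \<in> events" using B by measurable
  have lim: "AE \<omega> in M. (\<lambda>m. indicator (E m) \<omega> :: real) \<longlonglongrightarrow> indicator ?G \<omega>"
    using AE_unbounded AE_simple_jumps AE_space
  proof eventually_elim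
    fix \<omega> assume reach: "\<forall>j. \<exists>s\<ge>0. j \<le> N s \<omega>" and simple: "\<forall>j. N (J j \<omega>) \<omega> = j" and \<omega>: "\<omega> \<in> space M"
    interpret counting_path "\<lambda>s. N s \<omega>" by (rule path[OF \<omega>])
    have le_iff: "J j \<omega> \<le> u \<longleftrightarrow> j \<le> N u \<omega>" if "0 \<le> u" for j u
      unfolding J_def using jump_time_le_iff reach that by blast
    have J0: "0 \<le> J j \<omega>" for j unfolding J_def using jump_time_nonneg reach by blast
    show "(\<lambda>m. indicator (E m) \<omega> :: real) \<longlonglongrightarrow> indicator ?G \<omega>"
    proof (cases "\<omega> \<in> B")
      case False
      then show ?thesis by (simp add: E_def C_def)
    next
      case True
      obtain b where b: "J i \<omega> < b" "\<And>u. J i \<omega> \<le> u \<Longrightarrow> u < b \<Longrightarrow> N u \<omega> = N (J i \<omega>) \<omega>"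
        using path_locally_constant[OF J0] by metis
      have J0r: "0 \<le> J i \<omega> + r" using J0[of i] r by simp
      obtain b' where b': "J i \<omega> + r < b'" "\<And>u. J i \<omega> + r \<le> u \<Longrightarrow> u < b' \<Longrightarrow> N u \<omega> = N (J i \<omega> + r) \<omega>"
        using path_locally_constant[OF J0r] by metis
      have "h \<longlonglongrightarrow> 0" unfolding h_def[abs_def] by (rule LIMSEQ_Suc[OF lim_1_over_n])
      then have "eventually (\<lambda>m. h m < min (b - J i \<omega>) (b' - (J i \<omega> + r))) sequentially"
        by (rule order_tendstoD) (use b b' in auto)
      then have "eventually (\<lambda>m. indicator (E m) \<omega> = (indicator ?G \<omega> :: real)) sequentially"
      proof eventually_elim
        fix m assume m: "h m < min (b - J i \<omega>) (b' - (J i \<omega> + r))"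
        have key: "\<omega> \<in> I m q \<longleftrightarrow> r < waiting_time i \<omega>" if q: "\<omega> \<in> C m q" for q
        proof -
          have lo: "J i \<omega> \<le> g m q" using q le_iff[OF g0] by (auto simp: C_def)
          have hi: "g m q < J i \<omega> + h m"
          proof (cases "q = 0")
            case True
            then show ?thesis using h[of m] J0[of i] by (simp add: g_def)
          next
            case False
            then have "g m (q - 1) < J i \<omega>" using q le_iff[OF g0[of m "q - 1"], of i] by (auto simp: C_def)
            moreover have "g m q = g m (q - 1) + h m" using False by (simp add: g_def of_nat_diff algebra_simps)
            ultimately show ?thesis by simp
          qed
          have "N (g m q) \<omega> = i" using b(2)[OF lo] hi m simple by simp
          moreover have "N (g m q + r) \<omega> = N (J i \<omega> + r) \<omega>" using b'(2)[of "g m q + r"] lo hi m by simp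
          ultimately have "\<omega> \<in> I m q \<longleftrightarrow> \<not> Suc i \<le> N (J i \<omega> + r) \<omega>"
            using \<omega> by (auto simp: I_def)
          also have "\<dots> \<longleftrightarrow> r < waiting_time i \<omega>"
            unfolding le_iff[OF J0r, symmetric] waiting_time_eq by auto
          finally show ?thesis .
        qed
        obtain q where "\<omega> \<in> C m q" using C_ex[OF True] reach by blast
        with key have "\<omega> \<in> E m \<longleftrightarrow> r < waiting_time i \<omega>" unfolding E_def by blast
        then show "indicator (E m) \<omega> = (indicator ?G \<omega> :: real)"
          using True \<omega> by (simp add: indicator_def)
      qed
      then show ?thesis by (rule tendsto_eventually)
    qed
  qed
  have "(\<lambda>m. \<integral>\<omega>. indicator (E m) \<omega> \<partial>M) \<longlonglongrightarrow> (\<integral>\<omega>. indicator ?G \<omega> \<partial>M :: real)"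
  proof (rule integral_dominated_convergence[where w = "\<lambda>_. 1"])
    show "(indicator ?G :: 'a \<Rightarrow> real) \<in> borel_measurable M"
      "(indicator (E m) :: 'a \<Rightarrow> real) \<in> borel_measurable M" for m
      using E_ev G_ev by auto
    show "AE \<omega> in M. norm (indicator (E m) \<omega> :: real) \<le> 1" for m by (simp add: indicator_def)
  qed (use lim in auto)
  then have "(\<lambda>m. prob (E m)) \<longlonglongrightarrow> prob ?G"
    using E_ev G_ev by (simp add: sets.Int_space_eq2)
  then show ?thesis unfolding prob_E by (simp add: LIMSEQ_const_iff)
qed

lemma AE_waiting_time_pos: "AE \<omega> in M. 0 < waiting_time i \<omega>"
  using AE_unbounded AE_simple_jumps AE_space
proof eventually_elim
  fix \<omega> assume reach: "\<forall>j. \<exists>s\<ge>0. j \<le> N s \<omega>" and simple: "\<forall>j. N (J j \<omega>) \<omega> = j" and \<omega>: "\<omega> \<in> space M"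
  interpret counting_path "\<lambda>s. N s \<omega>" by (rule path[OF \<omega>])
  have "\<not> J (Suc i) \<omega> \<le> J i \<omega>"
    unfolding J_def using jump_time_le_iff[of "Suc i" "jump_time (\<lambda>s. N s \<omega>) i"] jump_time_nonneg[of i]
      reach simple[rule_format, of i] by (simp add: J_def)
  then show "0 < waiting_time i \<omega>" by (simp add: waiting_time_eq)
qed

lemma waiting_time_tail:
  assumes "0 < r"
  shows "prob {\<omega>\<in>space M. r < waiting_time i \<omega>} = exp (- rate * r)"
proof -
  have "space M \<inter> {\<omega>\<in>space M. i \<le> N u \<omega>} \<in> sets (past u)" if "0 \<le> u" for u
  proof -
    have "N u -` {i..} \<inter> space (past u) \<in> sets (past u)"
      by (rule measurable_sets[OF N_measurable_past]) (use that in auto)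
    also have "N u -` {i..} \<inter> space (past u) = space M \<inter> {\<omega>\<in>space M. i \<le> N u \<omega>}" by auto
    finally show ?thesis .
  qed
  from waiting_time_after[OF sets.top this assms] show ?thesis
    by (simp add: prob_space Int_absorb1 subset_iff)
qed

lemma waiting_time_distributed: "distributed M lborel (waiting_time i) (exponential_density rate)"
  unfolding exponential_distributed_iff[OF rate_pos]
proof (intro conjI allI impI)
  fix a :: real assume a: "0 \<le> a"
  have "prob {\<omega>\<in>space M. a < waiting_time i \<omega>} = exp (- a * rate)"
  proof (cases "a = 0")
    case True
    have "prob {\<omega>\<in>space M. 0 < waiting_time i \<omega>} = 1"
      using AE_waiting_time_pos[of i] by (subst prob_Collect_eq_1) auto
    with True show ?thesis by simp
  next
    case False
    with a waiting_time_tail[of a i] show ?thesis by (simp add: mult.commute)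
  qed
  moreover have "{\<omega>\<in>space M. waiting_time i \<omega> \<le> a} = space M - {\<omega>\<in>space M. a < waiting_time i \<omega>}" by auto
  ultimately show "prob {\<omega>\<in>space M. waiting_time i \<omega> \<le> a} = 1 - exp (- a * rate)"
    by (simp add: prob_compl)
qed simp

definition earlier_waits :: "nat \<Rightarrow> 'a \<Rightarrow> nat \<Rightarrow> real" where
  "earlier_waits i \<omega> = (\<lambda>j\<in>{..<i}. waiting_time j \<omega>)"

lemma earlier_waits_measurable [measurable]: "earlier_waits i \<in> measurable M (PiM {..<i} (\<lambda>_. borel))"
  unfolding earlier_waits_def[abs_def] by measurable

text \<open>
  If \<open>i\<close> events have occurred by time \<open>u\<close>, the first \<open>i\<close> event times are not changed by truncating them at
  \<open>u\<close>, and the truncated times depend only on the counts up to \<open>u\<close>.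
\<close>

lemma earlier_waits_event_past:
  assumes S: "S \<in> sets (PiM {..<i} (\<lambda>_. borel))" and u: "0 \<le> u"
  shows "(earlier_waits i -` S \<inter> space M) \<inter> {\<omega>\<in>space M. i \<le> N u \<omega>} \<in> sets (past u)"
proof -
  define K where "K j \<omega> = (if j \<le> N u \<omega> then J j \<omega> else u)" for j \<omega>
  have N_meas: "{\<omega>\<in>space M. j \<le> N a \<omega>} \<in> sets (past u)" if "0 \<le> a" "a \<le> u" for j a
  proof -
    have "N a -` {j..} \<inter> space (past u) \<in> sets (past u)"
      by (rule measurable_sets[OF N_measurable_past]) (use that in auto)
    also have "N a -` {j..} \<inter> space (past u) = {\<omega>\<in>space M. j \<le> N a \<omega>}" by auto
    finally show ?thesis .
  qed
  have K_le: "K j \<omega> \<le> a \<longleftrightarrow> u \<le> a \<or> 0 \<le> a \<and> j \<le> N a \<omega>" if \<omega>: "\<omega> \<in> space M" for j \<omega> a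
  proof (cases "j \<le> N u \<omega>")
    case True
    interpret counting_path "\<lambda>s. N s \<omega>" by (rule path[OF \<omega>])
    have reach: "\<exists>s\<ge>0. j \<le> N s \<omega>" using True u by blast
    have "J j \<omega> \<le> u" "0 \<le> J j \<omega>" "0 \<le> a \<Longrightarrow> J j \<omega> \<le> a \<longleftrightarrow> j \<le> N a \<omega>"
      unfolding J_def using jump_time_le_iff[OF reach] jump_time_nonneg[OF reach] u True by auto
    with True show ?thesis by (auto simp: K_def)
  next
    case False
    then show ?thesis using N_le[OF \<omega>, of a u] by (cases "u \<le> a") (auto simp: K_def)
  qed
  have K: "K j \<in> borel_measurable (past u)" for j
    unfolding borel_measurable_iff_le
  proof
    fix a
    have "{\<omega>\<in>space M. K j \<omega> \<le> a} = (if u \<le> a then space M else if 0 \<le> a then {\<omega>\<in>space M. j \<le> N a \<omega>} else {})"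
      using K_le by auto
    also have "\<dots> \<in> sets (past u)" using N_meas[of a j] sets.top[of "past u"] by auto
    finally show "{\<omega>\<in>space (past u). K j \<omega> \<le> a} \<in> sets (past u)" by simp
  qed
  have "(\<lambda>\<omega>. \<lambda>j\<in>{..<i}. K (Suc j) \<omega> - K j \<omega>) \<in> measurable (past u) (PiM {..<i} (\<lambda>_. borel))"
    by (intro measurable_restrict borel_measurable_diff K)
  from measurable_sets[OF this S] N_meas[OF u order_refl, of i]
  have "((\<lambda>\<omega>. \<lambda>j\<in>{..<i}. K (Suc j) \<omega> - K j \<omega>) -` S \<inter> space M) \<inter> {\<omega>\<in>space M. i \<le> N u \<omega>} \<in> sets (past u)"
    by (simp add: sets.Int)
  also have "((\<lambda>\<omega>. \<lambda>j\<in>{..<i}. K (Suc j) \<omega> - K j \<omega>) -` S \<inter> space M) \<inter> {\<omega>\<in>space M. i \<le> N u \<omega>}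
     = (earlier_waits i -` S \<inter> space M) \<inter> {\<omega>\<in>space M. i \<le> N u \<omega>}"
  proof -
    have "(\<lambda>j\<in>{..<i}. K (Suc j) \<omega> - K j \<omega>) = earlier_waits i \<omega>" if "i \<le> N u \<omega>" for \<omega>
      unfolding earlier_waits_def by (rule restrict_ext) (use that in \<open>auto simp: K_def waiting_time_eq\<close>)
    then show ?thesis by auto
  qed
  finally show ?thesis .
qed

text \<open>
  The two variables take values in different types, so independence is stated for
  rectangles. The half-lines generate the Borel sets, so the tail formula suffices.
\<close>

lemma waiting_time_indep:
  assumes S: "S \<in> sets (PiM {..<i} (\<lambda>_. borel))" and A: "A \<in> sets borel"
  shows "prob ((earlier_waits i -` S \<inter> space M) \<inter> (waiting_time i -` A \<inter> space M))
    = prob (earlier_waits i -` S \<inter> space M) * prob (waiting_time i -` A \<inter> space M)"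
proof -
  let ?A = "{earlier_waits i -` S \<inter> space M |S. S \<in> sets (PiM {..<i} (\<lambda>_. borel))}"
  let ?T = "\<lambda>r. waiting_time i -` {r<..} \<inter> space M"
  have T: "?T r = {\<omega>\<in>space M. r < waiting_time i \<omega>}" for r by auto
  have indep: "indep_set (sigma_sets (space M) ?A) (sigma_sets (space M) (range ?T))"
  proof (rule indep_set_sigma_sets)
    show "indep_set ?A (range ?T)"
    proof (rule indep_setI)
      fix a b assume "a \<in> ?A" "b \<in> range ?T"
      then obtain S r where S: "S \<in> sets (PiM {..<i} (\<lambda>_. borel))"
        and a: "a = earlier_waits i -` S \<inter> space M" and b: "b = {\<omega>\<in>space M. r < waiting_time i \<omega>}"
        unfolding T by auto
      have a_ev: "a \<in> events" unfolding a by (rule measurable_sets[OF earlier_waits_measurable S])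
      show "prob (a \<inter> b) = prob a * prob b"
      proof (cases "0 < r")
        case True
        show ?thesis
          unfolding b waiting_time_tail[OF True]
          by (rule waiting_time_after[OF a_ev _ True]) (unfold a, rule earlier_waits_event_past[OF S])
      next
        case False
        have "prob b = 1" unfolding b
          by (subst prob_Collect_eq_1) (use AE_waiting_time_pos[of i] False in \<open>auto elim!: eventually_mono\<close>)
        moreover have "prob (a \<inter> b) = prob a"
        proof (rule finite_measure_eq_AE)
          show "AE \<omega> in M. \<omega> \<in> a \<inter> b \<longleftrightarrow> \<omega> \<in> a"
            using AE_waiting_time_pos[of i] AE_space by eventually_elim (use False in \<open>auto simp: b\<close>)
        qed (use a_ev b in auto)
        ultimately show ?thesis by simp
      qed
    qed (use measurable_sets[OF earlier_waits_measurable] in auto)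
    show "Int_stable ?A"
    proof (rule Int_stableI)
      fix a b assume "a \<in> ?A" "b \<in> ?A"
      then obtain S S' where "S \<in> sets (PiM {..<i} (\<lambda>_. borel))" "S' \<in> sets (PiM {..<i} (\<lambda>_. borel))"
        "a = earlier_waits i -` S \<inter> space M" "b = earlier_waits i -` S' \<inter> space M" by auto
      then show "a \<inter> b \<in> ?A" by (intro CollectI exI[of _ "S \<inter> S'"]) auto
    qed
    show "Int_stable (range ?T)"
    proof (rule Int_stableI)
      fix a b assume "a \<in> range ?T" "b \<in> range ?T"
      then obtain r r' where "a = ?T r" "b = ?T r'" by auto
      then have "a \<inter> b = ?T (max r r')" by auto
      then show "a \<inter> b \<in> range ?T" by blast
    qed
  qed
  have sub: "{waiting_time i -` A \<inter> space M |A. A \<in> sets borel} \<subseteq> sigma_sets (space M) (range ?T)"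
  proof -
    have "sets (borel :: real measure) = sigma_sets UNIV (range greaterThan)"
      by (subst borel_Ioi) simp
    then have "{waiting_time i -` A \<inter> space M |A. A \<in> sets borel}
        = {waiting_time i -` A \<inter> space M |A. A \<in> sigma_sets UNIV (range greaterThan)}" by simp
    also have "\<dots> = sigma_sets (space M) {waiting_time i -` A \<inter> space M |A. A \<in> range greaterThan}"
      by (rule sigma_sets_vimage_commute) simp
    also have "{waiting_time i -` A \<inter> space M |A. A \<in> range greaterThan} = range ?T" by auto
    finally show "{waiting_time i -` A \<inter> space M |A. A \<in> sets borel} \<subseteq> sigma_sets (space M) (range ?T)" by simp
  qed
  show ?thesis
  proof (rule indep_setD[OF indep])
    show "earlier_waits i -` S \<inter> space M \<in> sigma_sets (space M) ?A"
      using S by (intro sigma_sets.Basic) blast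
    show "waiting_time i -` A \<inter> space M \<in> sigma_sets (space M) (range ?T)"
      using sub A by blast
  qed
qed

text \<open>
  The form in which the independence is used: the current waiting time may be integrated out first, with the
  earlier ones held fixed.
\<close>

lemma nn_integral_waiting_time:
  assumes \<phi>: "case_prod \<phi> \<in> borel_measurable (PiM {..<i} (\<lambda>_. borel) \<Otimes>\<^sub>M borel)"
  shows "(\<integral>\<^sup>+\<omega>. \<phi> (earlier_waits i \<omega>) (waiting_time i \<omega>) \<partial>M)
    = (\<integral>\<^sup>+\<omega>. (\<integral>\<^sup>+r. ennreal (exponential_density rate r) * \<phi> (earlier_waits i \<omega>) r \<partial>lborel) \<partial>M)"
proof -
  let ?P = "PiM {..<i} (\<lambda>_. borel) :: (nat \<Rightarrow> real) measure"
  note [measurable] = \<phi>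
  have dW: "distr M borel (waiting_time i) = density lborel (exponential_density rate)"
    using distributed_distr_eq_density[OF waiting_time_distributed[of i]]
    by (subst distr_cong[of M M borel lborel]) auto
  interpret E: prob_space "density lborel (exponential_density rate)"
    by (rule prob_space_exponential_density[OF rate_pos])
  have joint: "distr M ?P (earlier_waits i) \<Otimes>\<^sub>M density lborel (exponential_density rate)
      = distr M (?P \<Otimes>\<^sub>M borel) (\<lambda>\<omega>. (earlier_waits i \<omega>, waiting_time i \<omega>))"
    (is "?L = ?R")
  proof (rule pair_measure_eqI)
    interpret G: prob_space "distr M ?P (earlier_waits i)" by (rule prob_space_distr) measurable
    show "sigma_finite_measure (distr M ?P (earlier_waits i))" by unfold_locales
    show "sigma_finite_measure (density lborel (exponential_density rate))" by unfold_locales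
    show "sets ?L = sets ?R" by (simp cong: sets_pair_measure_cong)
    fix S A assume "S \<in> sets (distr M ?P (earlier_waits i))" "A \<in> sets (density lborel (exponential_density rate))"
    then have S: "S \<in> sets ?P" and A: "A \<in> sets borel" by auto
    have "(\<lambda>\<omega>. (earlier_waits i \<omega>, waiting_time i \<omega>)) -` (S \<times> A) \<inter> space M
        = (earlier_waits i -` S \<inter> space M) \<inter> (waiting_time i -` A \<inter> space M)" by auto
    then show "emeasure (distr M ?P (earlier_waits i)) S * emeasure (density lborel (exponential_density rate)) A
        = emeasure ?R (S \<times> A)"
      unfolding dW[symmetric] using S A waiting_time_indep[OF S A]
      by (simp add: emeasure_distr emeasure_eq_measure ennreal_mult)
  qed
  have "(\<integral>\<^sup>+\<omega>. \<phi> (earlier_waits i \<omega>) (waiting_time i \<omega>) \<partial>M)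
      = (\<integral>\<^sup>+p. case_prod \<phi> p \<partial>distr M (?P \<Otimes>\<^sub>M borel) (\<lambda>\<omega>. (earlier_waits i \<omega>, waiting_time i \<omega>)))"
    by (subst nn_integral_distr) auto
  also have "\<dots> = (\<integral>\<^sup>+e. (\<integral>\<^sup>+r. \<phi> e r \<partial>density lborel (exponential_density rate)) \<partial>distr M ?P (earlier_waits i))"
    unfolding joint[symmetric] by (subst E.nn_integral_fst[symmetric]) auto
  also have "\<dots> = (\<integral>\<^sup>+e. (\<integral>\<^sup>+r. ennreal (exponential_density rate r) * \<phi> e r \<partial>lborel) \<partial>distr M ?P (earlier_waits i))"
    by (intro nn_integral_cong nn_integral_density) (auto simp: space_PiM)
  also have "\<dots> = (\<integral>\<^sup>+\<omega>. (\<integral>\<^sup>+r. ennreal (exponential_density rate r) * \<phi> (earlier_waits i \<omega>) r \<partial>lborel) \<partial>M)"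
    by (subst nn_integral_distr) auto
  finally show ?thesis .
qed

end

section \<open>Survival of a walk in a wedge\<close>

text \<open>
  With divided powers, differentiation merely shifts the index, and binomial coefficients stay
  out of the recursion.
\<close>

definition divided_power :: "real \<Rightarrow> nat \<Rightarrow> real" where
  "divided_power a j = a ^ j / fact j"

lemma divided_power_0 [simp]: "divided_power a 0 = 1"
  by (simp add: divided_power_def)

lemma divided_power_zero: "divided_power 0 j = (if j = 0 then 1 else 0)"
  by (cases j) (simp_all add: divided_power_def)

lemma divided_power_nonneg: "0 \<le> a \<Longrightarrow> 0 \<le> divided_power a j"
  by (simp add: divided_power_def)

lemma DERIV_divided_power_Suc: "((\<lambda>x. divided_power x (Suc j)) has_real_derivative divided_power x j) (at x)"
proof -
  have "((\<lambda>x. x ^ Suc j / fact (Suc j)) has_real_derivative real (Suc j) * x ^ j / fact (Suc j)) (at x)"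
    by (rule DERIV_cdivide) (use DERIV_pow[of "Suc j" x] in simp)
  moreover have "real (Suc j) * x ^ j / fact (Suc j) = x ^ j / fact j"
    by (simp add: field_simps del: of_nat_Suc)
  ultimately show ?thesis unfolding divided_power_def by simp
qed

lemma DERIV_divided_power_pos:
  "0 < j \<Longrightarrow> ((\<lambda>x. divided_power x j) has_real_derivative divided_power x (j - 1)) (at x)"
  using DERIV_divided_power_Suc[of "j - 1" x] by simp

text \<open>
  For \<open>x \<ge> 0\<close> and \<open>\<rho> x \<le> y\<close> these are, up to scaling, the volumes of the sets of leg durations that keep the
  walk from \<open>(x, y)\<close> in the wedge: \<open>down_poly \<rho> q\<close> with \<open>2 q\<close> moves left, beginning downwards, and
  \<open>up_poly \<rho> q\<close> with \<open>2 q + 1\<close> moves left, beginning upwards.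
\<close>

definition down_poly :: "real \<Rightarrow> nat \<Rightarrow> real \<Rightarrow> real \<Rightarrow> real" where
  "down_poly \<rho> q x y =
     (\<Sum>j\<le>q. divided_power x j * divided_power y (2 * q - j))
     - (\<Sum>j<q. \<rho> ^ (2 * q - 1 - 2 * j) * divided_power x (2 * q - j) * divided_power y j)"

definition up_poly :: "real \<Rightarrow> nat \<Rightarrow> real \<Rightarrow> real \<Rightarrow> real" where
  "up_poly \<rho> q x y =
     (\<Sum>j\<le>q. divided_power x j * divided_power y (2 * q + 1 - j))
     - (\<Sum>j\<le>q. \<rho> ^ (2 * q + 1 - 2 * j) * divided_power x (2 * q + 1 - j) * divided_power y j)"

lemma DERIV_down_poly:
  "((\<lambda>x. down_poly \<rho> (Suc q) x y) has_real_derivative up_poly \<rho> q x y) (at x)"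
proof -
  have 1: "((\<lambda>x. \<Sum>j\<le>Suc q. divided_power x j * divided_power y (2 * Suc q - j)) has_real_derivative
      (\<Sum>j\<le>q. divided_power x j * divided_power y (2 * q + 1 - j))) (at x)"
    unfolding sum.atMost_Suc_shift
    by (auto intro!: derivative_eq_intros DERIV_divided_power_Suc)
  have 2: "((\<lambda>x. \<Sum>j<Suc q. \<rho> ^ (2 * Suc q - 1 - 2 * j) * divided_power x (2 * Suc q - j) * divided_power y j)
      has_real_derivative
      (\<Sum>j<Suc q. \<rho> ^ (2 * Suc q - 1 - 2 * j) * divided_power x (2 * Suc q - j - 1) * divided_power y j)) (at x)"
    by (intro DERIV_sum DERIV_cmult_right DERIV_cmult DERIV_divided_power_pos) auto
  have "(\<Sum>j<Suc q. \<rho> ^ (2 * Suc q - 1 - 2 * j) * divided_power x (2 * Suc q - j - 1) * divided_power y j)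
      = (\<Sum>j\<le>q. \<rho> ^ (2 * q + 1 - 2 * j) * divided_power x (2 * q + 1 - j) * divided_power y j)"
    by (rule sum.cong) (auto simp: lessThan_Suc_atMost)
  with DERIV_diff[OF 1 2] show ?thesis
    unfolding down_poly_def up_poly_def by simp
qed

lemma DERIV_up_poly:
  "((\<lambda>y. up_poly \<rho> q x y) has_real_derivative down_poly \<rho> q x y) (at y)"
proof -
  have 1: "((\<lambda>y. \<Sum>j\<le>q. divided_power x j * divided_power y (2 * q + 1 - j)) has_real_derivative
      (\<Sum>j\<le>q. divided_power x j * divided_power y (2 * q + 1 - j - 1))) (at y)"
    by (intro DERIV_sum DERIV_cmult DERIV_divided_power_pos) auto
  have 3: "(\<Sum>j\<le>q. divided_power x j * divided_power y (2 * q + 1 - j - 1))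
      = (\<Sum>j\<le>q. divided_power x j * divided_power y (2 * q - j))"
    by (rule sum.cong) auto
  have 2: "((\<lambda>y. \<Sum>j<Suc q. \<rho> ^ (2 * q + 1 - 2 * j) * divided_power x (2 * q + 1 - j) * divided_power y j)
      has_real_derivative
      (\<Sum>j<q. \<rho> ^ (2 * q + 1 - 2 * Suc j) * divided_power x (2 * q + 1 - Suc j) * divided_power y j)) (at y)"
    unfolding sum.lessThan_Suc_shift
    by (auto intro!: derivative_eq_intros DERIV_divided_power_Suc simp: mult_ac)
  have 4: "(\<Sum>j<q. \<rho> ^ (2 * q + 1 - 2 * Suc j) * divided_power x (2 * q + 1 - Suc j) * divided_power y j)
      = (\<Sum>j<q. \<rho> ^ (2 * q - 1 - 2 * j) * divided_power x (2 * q - j) * divided_power y j)"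
    by (rule sum.cong) auto
  from DERIV_diff[OF 1 2] show ?thesis
    unfolding down_poly_def up_poly_def 3 4 lessThan_Suc_atMost .
qed

text \<open>
  An upward move from the barrier leaves the wedge at once. Algebraically, the two sums agree term by term at
  \<open>y = \<rho> x\<close>.
\<close>

lemma up_poly_barrier: "up_poly \<rho> q x (\<rho> * x) = 0"
proof -
  have "divided_power x j * divided_power (\<rho> * x) (2 * q + 1 - j)
      = \<rho> ^ (2 * q + 1 - 2 * j) * divided_power x (2 * q + 1 - j) * divided_power (\<rho> * x) j" if "j \<le> q" for j
  proof -
    have "2 * q + 1 - j = (2 * q + 1 - 2 * j) + j" using that by simp
    then have "\<rho> ^ (2 * q + 1 - j) = \<rho> ^ (2 * q + 1 - 2 * j) * \<rho> ^ j"
      by (metis power_add)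
    then show ?thesis by (simp add: divided_power_def power_mult_distrib mult_ac)
  qed
  then show ?thesis by (simp add: up_poly_def)
qed

lemma down_poly_0: "down_poly \<rho> q 0 y = divided_power y (2 * q)"
proof -
  have a: "(\<Sum>j\<le>q. divided_power 0 j * divided_power y (2 * q - j)) = (\<Sum>j\<le>q. if j = 0 then divided_power y (2 * q) else 0)"
    by (rule sum.cong) (auto simp: divided_power_zero)
  have b: "(\<Sum>j<q. \<rho> ^ (2 * q - 1 - 2 * j) * divided_power 0 (2 * q - j) * divided_power y j) = 0"
    by (rule sum.neutral) (auto simp: divided_power_zero)
  show ?thesis unfolding down_poly_def a b by simp
qed

lemma up_poly_0: "up_poly \<rho> q 0 y = divided_power y (2 * q + 1)"
proof -
  have a: "(\<Sum>j\<le>q. divided_power 0 j * divided_power y (2 * q + 1 - j)) = (\<Sum>j\<le>q. if j = 0 then divided_power y (2 * q + 1) else 0)"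
    by (rule sum.cong) (auto simp: divided_power_zero)
  have b: "(\<Sum>j\<le>q. \<rho> ^ (2 * q + 1 - 2 * j) * divided_power 0 (2 * q + 1 - j) * divided_power y j) = 0"
    by (rule sum.neutral) (auto simp: divided_power_zero)
  show ?thesis unfolding up_poly_def a b by simp
qed

text \<open>
  Each polynomial is an antiderivative of the previous one along a segment in the wedge, with a nonnegative
  value at the initial point: \<open>x = 0\<close> for \<open>down_poly\<close>, and the barrier for \<open>up_poly\<close>.
\<close>

lemma down_up_poly_nonneg:
  assumes "0 \<le> \<rho>"
  shows "0 \<le> x \<Longrightarrow> \<rho> * x \<le> y \<Longrightarrow> 0 \<le> down_poly \<rho> q x y \<and> 0 \<le> up_poly \<rho> q x y"
proof (induction q arbitrary: x y)
  case 0
  have "down_poly \<rho> 0 x y = 1" by (simp add: down_poly_def)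
  moreover have "up_poly \<rho> 0 x y = y - \<rho> * x" by (simp add: up_poly_def divided_power_def)
  ultimately show ?case using 0 by simp
next
  case (Suc q)
  have down: "0 \<le> down_poly \<rho> (Suc q) x y" if xy: "0 \<le> x" "\<rho> * x \<le> y" for x y
  proof -
    have "down_poly \<rho> (Suc q) 0 y \<le> down_poly \<rho> (Suc q) x y"
    proof (rule DERIV_nonneg_imp_nondecreasing[OF xy(1)])
      fix u assume u: "0 \<le> u" "u \<le> x"
      have "\<rho> * u \<le> y" using mult_left_mono[OF u(2) assms] xy by simp
      then show "\<exists>d. ((\<lambda>x. down_poly \<rho> (Suc q) x y) has_real_derivative d) (at u) \<and> 0 \<le> d"
        using DERIV_down_poly Suc.IH u by blast
    qed
    moreover have "0 \<le> y" using xy assms by (meson mult_nonneg_nonneg order_trans)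
    ultimately show ?thesis by (simp add: down_poly_0 divided_power_nonneg order_trans[rotated])
  qed
  have "up_poly \<rho> (Suc q) x (\<rho> * x) \<le> up_poly \<rho> (Suc q) x y"
    by (rule DERIV_nonneg_imp_nondecreasing[OF Suc.prems(2)])
       (use DERIV_up_poly down Suc.prems in blast)
  then show ?case using down Suc.prems by (simp add: up_poly_barrier)
qed

text \<open>
  The wedge in which there is time left and the level \<open>\<beta>\<close> is not exceeded.
\<close>

definition safe :: "real \<Rightarrow> real \<Rightarrow> (real \<times> real) set" where
  "safe c1 c2 = {z. 0 \<le> fst z + snd z \<and> c2 * fst z \<le> c1 * snd z}"

text \<open>
  Only the parity of \<open>m\<close> matters. It may be read as the number of moves made or of moves left, because
  their sum is even in the application.
\<close>

definition move :: "real \<Rightarrow> nat \<Rightarrow> real \<times> real \<Rightarrow> real \<Rightarrow> real \<times> real" where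
  "move c m z r = (if even m then (fst z - c * r, snd z) else (fst z, snd z - c * r))"

text \<open>
  Here \<open>m\<close> is the number of moves left, and \<open>(fst z + snd z) / (c1 + c2)\<close> is the remaining time, during which, in
  the base case, no event may occur.
\<close>

primrec survival :: "real \<Rightarrow> real \<Rightarrow> real \<Rightarrow> nat \<Rightarrow> real \<times> real \<Rightarrow> ennreal" where
  "survival l c1 c2 0 z = ennreal (exp (- l * (fst z + snd z) / (c1 + c2)))"
| "survival l c1 c2 (Suc m) z =
     (\<integral>\<^sup>+r. ennreal (exponential_density l r) *
        (indicator (safe c1 c2) (move (c1 + c2) (Suc m) z r) *
         survival l c1 c2 m (move (c1 + c2) (Suc m) z r)) \<partial>lborel)"

text \<open>
  For \<open>x \<le> 0\<close> even the fastest ascent in the remaining time does not cross the level. The constraint is then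
  void, and the volume is that of a simplex.
\<close>

definition wedge_volume :: "real \<Rightarrow> nat \<Rightarrow> real \<Rightarrow> real \<Rightarrow> real" where
  "wedge_volume \<rho> m x y = (if x \<le> 0 then divided_power (x + y) m
     else if even m then down_poly \<rho> (m div 2) x y else up_poly \<rho> (m div 2) x y)"

lemma closed_safe: "closed (safe c1 c2)"
  unfolding safe_def by (intro closed_Collect_conj closed_Collect_le continuous_intros)

lemma safe_measurable [measurable]: "safe c1 c2 \<in> sets borel"
  by (rule borel_closed[OF closed_safe])

lemma move_measurable [measurable]:
  "(\<lambda>p. move c m (fst p) (snd p)) \<in> borel_measurable (borel \<Otimes>\<^sub>M borel)"
  unfolding move_def borel_prod by (cases "even m") (auto intro!: borel_measurable_continuous_onI continuous_intros)

lemma survival_measurable [measurable]: "survival l c1 c2 m \<in> borel_measurable borel"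
proof (induction m)
  case 0
  show ?case
    unfolding survival.simps by (simp flip: borel_prod)
next
  case (Suc m)
  note [measurable] = Suc
  have "(\<lambda>p. ennreal (exponential_density l (snd p)) *
        (indicator (safe c1 c2) (move (c1 + c2) (Suc m) (fst p) (snd p)) *
         survival l c1 c2 m (move (c1 + c2) (Suc m) (fst p) (snd p))))
      \<in> borel_measurable (borel \<Otimes>\<^sub>M lborel)"
    by measurable
  then have "(\<lambda>z. \<integral>\<^sup>+r. ennreal (exponential_density l r) *
        (indicator (safe c1 c2) (move (c1 + c2) (Suc m) z r) *
         survival l c1 c2 m (move (c1 + c2) (Suc m) z r)) \<partial>lborel) \<in> borel_measurable borel"
    by (intro lborel.borel_measurable_nn_integral) (simp add: case_prod_beta)
  moreover have "survival l c1 c2 (Suc m) = (\<lambda>z. \<integral>\<^sup>+r. ennreal (exponential_density l r) *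
        (indicator (safe c1 c2) (move (c1 + c2) (Suc m) z r) *
         survival l c1 c2 m (move (c1 + c2) (Suc m) z r)) \<partial>lborel)"
    by (rule ext) simp
  ultimately show ?case by simp
qed

lemma nn_integral_interval_antiderivative:
  fixes F f :: "real \<Rightarrow> real"
  assumes "a \<le> b" "\<And>x. (F has_real_derivative f x) (at x)" "\<And>x. a \<le> x \<Longrightarrow> x \<le> b \<Longrightarrow> 0 \<le> f x"
    and "f \<in> borel_measurable borel"
    and "\<And>x. a < x \<Longrightarrow> x < b \<Longrightarrow> \<phi> x = f x"
  shows "(\<integral>\<^sup>+x. ennreal (\<phi> x) * indicator {a..b} x \<partial>lborel) = ennreal (F b - F a)"
proof -
  have "(\<integral>\<^sup>+x. ennreal (\<phi> x) * indicator {a..b} x \<partial>lborel)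
      = (\<integral>\<^sup>+x. ennreal (f x) * indicator {a..b} x \<partial>lborel)"
  proof (rule nn_integral_cong_AE)
    show "AE x in lborel. ennreal (\<phi> x) * indicator {a..b} x = ennreal (f x) * indicator {a..b} x"
      using AE_lborel_singleton[of a] AE_lborel_singleton[of b]
      by eventually_elim (use assms(5) in \<open>auto simp: indicator_def\<close>)
  qed
  also have "\<dots> = ennreal (F b - F a)"
    by (rule nn_integral_FTC_Icc) (use assms in auto)
  finally show ?thesis .
qed

lemma nn_integral_split_interval:
  fixes \<phi> :: "real \<Rightarrow> real"
  assumes "a \<le> b" "b \<le> d" and [measurable]: "\<phi> \<in> borel_measurable borel"
  shows "(\<integral>\<^sup>+x. ennreal (\<phi> x) * indicator {a..d} x \<partial>lborel)
    = (\<integral>\<^sup>+x. ennreal (\<phi> x) * indicator {a..b} x \<partial>lborel)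
      + (\<integral>\<^sup>+x. ennreal (\<phi> x) * indicator {b..d} x \<partial>lborel)"
proof -
  have "(\<integral>\<^sup>+x. ennreal (\<phi> x) * indicator {a..d} x \<partial>lborel)
      = (\<integral>\<^sup>+x. ennreal (\<phi> x) * indicator {a..b} x + ennreal (\<phi> x) * indicator {b..d} x \<partial>lborel)"
  proof (rule nn_integral_cong_AE)
    show "AE x in lborel. ennreal (\<phi> x) * indicator {a..d} x =
       ennreal (\<phi> x) * indicator {a..b} x + ennreal (\<phi> x) * indicator {b..d} x"
      using AE_lborel_singleton[of b]
      by eventually_elim (use assms in \<open>auto simp: indicator_def\<close>)
  qed
  also have "\<dots> = (\<integral>\<^sup>+x. ennreal (\<phi> x) * indicator {a..b} x \<partial>lborel)
      + (\<integral>\<^sup>+x. ennreal (\<phi> x) * indicator {b..d} x \<partial>lborel)"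
    by (rule nn_integral_add) measurable
  finally show ?thesis .
qed

lemma DERIV_divided_power_shift:
  "((\<lambda>x. divided_power (x + y) (Suc m)) has_real_derivative divided_power (x + y) m) (at x)"
  using DERIV_shift[of "\<lambda>x. divided_power x (Suc m)" "divided_power (x+y) m" x y] DERIV_divided_power_Suc by blast

lemma divided_power_measurable [measurable]: "(\<lambda>x. divided_power x m) \<in> borel_measurable borel"
  unfolding divided_power_def by (intro borel_measurable_continuous_onI continuous_intros) auto

lemma poly_measurable [measurable]:
  "(\<lambda>x. down_poly \<rho> q x y) \<in> borel_measurable borel" "(\<lambda>y. down_poly \<rho> q x y) \<in> borel_measurable borel"
  "(\<lambda>x. up_poly \<rho> q x y) \<in> borel_measurable borel" "(\<lambda>y. up_poly \<rho> q x y) \<in> borel_measurable borel"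
  unfolding down_poly_def up_poly_def by measurable

lemma wedge_volume_measurable [measurable]:
  "(\<lambda>x. wedge_volume \<rho> m x y) \<in> borel_measurable borel" "(\<lambda>y. wedge_volume \<rho> m x y) \<in> borel_measurable borel"
  unfolding wedge_volume_def by measurable

lemma wedge_volume_nonneg:
  assumes "0 \<le> \<rho>" "0 \<le> x + y" "\<rho> * x \<le> y"
  shows "0 \<le> wedge_volume \<rho> m x y"
  using down_up_poly_nonneg[OF assms(1), of x y] assms by (auto simp: wedge_volume_def divided_power_nonneg)

text \<open>
  A downward move lets \<open>x\<close> decrease until the time is used up at \<open>x = - y\<close>. For \<open>x > 0\<close> the path
  of integration is split at \<open>0\<close>, where the two formulas for the volume meet.
\<close>

lemma wedge_volume_step_down:
  assumes "0 \<le> \<rho>" "0 \<le> x + y" "\<rho> * x \<le> y" "odd m"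
  shows "(\<integral>\<^sup>+u. ennreal (wedge_volume \<rho> m u y) * indicator {-y..x} u \<partial>lborel) = ennreal (wedge_volume \<rho> (Suc m) x y)"
proof -
  obtain q where q: "m = 2 * q + 1" using \<open>odd m\<close> by (rule oddE)
  have neg: "(\<integral>\<^sup>+u. ennreal (wedge_volume \<rho> m u y) * indicator {-y..b} u \<partial>lborel) = ennreal (divided_power (b + y) (Suc m))"
    if "b \<le> 0" "- y \<le> b" for b
    by (subst nn_integral_interval_antiderivative[where F = "\<lambda>u. divided_power (u + y) (Suc m)"
          and f = "\<lambda>u. divided_power (u + y) m"])
       (use that in \<open>auto simp: DERIV_divided_power_shift divided_power_nonneg wedge_volume_def divided_power_zero\<close>)
  show ?thesis
  proof (cases "x \<le> 0")
    case True
    with neg[of x] assms show ?thesis by (simp add: wedge_volume_def)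
  next
    case False
    then have x: "0 < x" by simp
    have y: "0 \<le> y" using x assms by (meson less_imp_le mult_nonneg_nonneg order_trans)
    have pos: "(\<integral>\<^sup>+u. ennreal (wedge_volume \<rho> m u y) * indicator {0..x} u \<partial>lborel)
       = ennreal (down_poly \<rho> (Suc q) x y - down_poly \<rho> (Suc q) 0 y)"
    proof (rule nn_integral_interval_antiderivative)
      fix u assume u: "0 \<le> u" "u \<le> x"
      have "\<rho> * u \<le> y" using mult_left_mono[OF u(2) assms(1)] assms by simp
      then show "0 \<le> up_poly \<rho> q u y" using down_up_poly_nonneg[OF assms(1) u(1)] by simp
    qed (use x in \<open>auto simp: DERIV_down_poly wedge_volume_def q\<close>)
    have "down_poly \<rho> (Suc q) 0 y \<le> down_poly \<rho> (Suc q) x y"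
    proof (rule DERIV_nonneg_imp_nondecreasing[OF less_imp_le[OF x]])
      fix u assume u: "0 \<le> u" "u \<le> x"
      have "\<rho> * u \<le> y" using mult_left_mono[OF u(2) assms(1)] assms by simp
      then show "\<exists>d. ((\<lambda>x. down_poly \<rho> (Suc q) x y) has_real_derivative d) (at u) \<and> 0 \<le> d"
        using DERIV_down_poly down_up_poly_nonneg[OF assms(1)] u by blast
    qed
    then show ?thesis
      using nn_integral_split_interval[of "-y" 0 x "\<lambda>u. wedge_volume \<rho> m u y"] neg[of 0] x y pos
      by (simp add: wedge_volume_def q down_poly_0 divided_power_nonneg flip: ennreal_plus)
  qed
qed

text \<open>
  An upward move lets \<open>y\<close> decrease until it hits the barrier \<open>y = \<rho> x\<close>, if \<open>x > 0\<close>, or the time is used up,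
  if \<open>x \<le> 0\<close>.
\<close>

lemma wedge_volume_step_up:
  assumes "0 \<le> \<rho>" "0 \<le> x + y" "\<rho> * x \<le> y" "even m"
  shows "(\<integral>\<^sup>+u. ennreal (wedge_volume \<rho> m x u) * indicator {max (- x) (\<rho> * x)..y} u \<partial>lborel) = ennreal (wedge_volume \<rho> (Suc m) x y)"
proof (cases "x \<le> 0")
  case True
  have "\<rho> * x \<le> 0" using True assms(1) by (simp add: mult_nonneg_nonpos)
  then have mx: "max (- x) (\<rho> * x) = - x" using True by simp
  have DERIV: "((\<lambda>u. divided_power (x + u) (Suc m)) has_real_derivative divided_power (x + u) m) (at u)" for u
    using DERIV_divided_power_shift[of x m u] by (simp add: add.commute)
  show ?thesis unfolding mx
    by (subst nn_integral_interval_antiderivative[where F = "\<lambda>u. divided_power (x + u) (Suc m)"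
          and f = "\<lambda>u. divided_power (x + u) m"])
       (use True assms DERIV in \<open>auto simp: divided_power_nonneg wedge_volume_def divided_power_zero\<close>)
next
  case False
  then have x: "0 < x" by simp
  obtain q where q: "m = 2 * q" using \<open>even m\<close> by (rule evenE)
  have "0 \<le> \<rho> * x" using x assms(1) by simp
  then have mx: "max (- x) (\<rho> * x) = \<rho> * x" using x by simp
  show ?thesis unfolding mx
    by (subst nn_integral_interval_antiderivative[where F = "\<lambda>u. up_poly \<rho> q x u"
          and f = "\<lambda>u. down_poly \<rho> q x u"])
       (use x assms down_up_poly_nonneg[OF assms(1)] DERIV_up_poly in
         \<open>auto simp: wedge_volume_def q up_poly_barrier\<close>)
qed

text \<open>
  The exponential density of the waiting time \<open>r\<close> and the factor for the time \<open>s / c - r\<close> that remains after it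
  multiply to a constant, so that averaging over the waiting time is a plain integral along the segment.
\<close>

lemma exponential_step_integral:
  fixes g :: "real \<Rightarrow> real"
  assumes l: "0 < l" and c: "0 < c" and K: "0 \<le> K"
    and [measurable]: "g \<in> borel_measurable borel" and g: "\<And>u. a \<le> u \<Longrightarrow> u \<le> x \<Longrightarrow> 0 \<le> g u"
    and int: "(\<integral>\<^sup>+u. ennreal (g u) * indicator {a..x} u \<partial>lborel) = ennreal G"
    and h: "\<And>r. 0 \<le> r \<Longrightarrow> h r = indicator {a..x} (x - c * r) * ennreal (K * exp (- l * (s - c * r) / c) * g (x - c * r))"
  shows "(\<integral>\<^sup>+r. ennreal (exponential_density l r) * h r \<partial>lborel) = ennreal (K * (l / c) * exp (- l * s / c) * G)"
proof -
  let ?C = "K * (l / c) * exp (- l * s / c)"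
  have C: "0 \<le> ?C" using l c K by simp
  have eq: "ennreal (exponential_density l r) * h r
      = ennreal ?C * (ennreal c * (ennreal (g (x - c * r)) * indicator {a..x} (x - c * r)))" for r
  proof (cases "0 \<le> r \<and> a \<le> x - c * r")
    case True
    then have r: "0 \<le> r" "a \<le> x - c * r" by auto
    have rx: "x - c * r \<le> x" using c r by simp
    have e: "exp (- (r * l)) * exp (- (l * (s - c * r)) / c) = exp (- (l * s) / c)"
      using c by (simp add: field_simps flip: exp_add)
    have g': "0 \<le> g (x - c * r)" using g r rx by blast
    have "exponential_density l r * (K * exp (- l * (s - c * r) / c) * g (x - c * r))
        = l * K * (exp (- (r * l)) * exp (- (l * (s - c * r)) / c)) * g (x - c * r)"
      using r by (simp add: exponential_density_def)
    also have "\<dots> = ?C * (c * g (x - c * r))"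
      unfolding e using c by simp
    finally show ?thesis
      using r rx g' C c K l unfolding h[OF r(1)]
      by (simp add: exponential_density_nonneg ennreal_mult'[symmetric] ennreal_mult''[symmetric] del: erlang_density_def)
  next
    case False
    have "h r = 0 \<or> r < 0" using False h[of r] by (auto simp: indicator_def)
    moreover have "r < 0 \<Longrightarrow> x < x - c * r" using c by (simp add: mult_pos_neg)
    ultimately show ?thesis using False by (auto simp: exponential_density_def indicator_def)
  qed
  have "(\<integral>\<^sup>+r. ennreal (exponential_density l r) * h r \<partial>lborel)
      = ennreal ?C * (ennreal c * (\<integral>\<^sup>+r. ennreal (g (x - c * r)) * indicator {a..x} (x - c * r) \<partial>lborel))"
    unfolding eq by (simp add: nn_integral_cmult)
  also have "ennreal c * (\<integral>\<^sup>+r. ennreal (g (x - c * r)) * indicator {a..x} (x - c * r) \<partial>lborel)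
      = (\<integral>\<^sup>+u. ennreal (g u) * indicator {a..x} u \<partial>lborel)"
    using nn_integral_real_affine[of "\<lambda>u. ennreal (g u) * indicator {a..x} u" "- c" x] c by simp
  also have "ennreal ?C * \<dots> = ennreal (?C * G)"
    unfolding int by (rule ennreal_mult'[OF C, symmetric])
  finally show ?thesis .
qed

lemma survival_eq:
  assumes l: "0 < l" and c1: "0 < c1" and c2: "0 < c2"
  shows "z \<in> safe c1 c2 \<Longrightarrow> survival l c1 c2 m z =
    ennreal ((l / (c1 + c2)) ^ m * exp (- l * (fst z + snd z) / (c1 + c2)) * wedge_volume (c2 / c1) m (fst z) (snd z))"
proof (induction m arbitrary: z)
  case 0
  then show ?case by (auto simp: wedge_volume_def down_poly_def safe_def)
next
  case (Suc m)
  obtain x y where z: "z = (x, y)" by (cases z)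
  let ?c = "c1 + c2" and ?\<rho> = "c2 / c1"
  have c: "0 < ?c" and \<rho>: "0 \<le> ?\<rho>" using c1 c2 by auto
  have safe_iff: "(u, v) \<in> safe c1 c2 \<longleftrightarrow> 0 \<le> u + v \<and> ?\<rho> * u \<le> v" for u v
    using c1 by (auto simp: safe_def field_simps)
  have xy: "0 \<le> x + y" "?\<rho> * x \<le> y" using Suc.prems z safe_iff by auto
  show ?case
  proof (cases "odd m")
    case True
    have ev: "even (Suc m)" using True by simp
    have "survival l c1 c2 (Suc m) z = ennreal ((l / ?c) ^ m * (l / ?c) * exp (- l * (x + y) / ?c) * wedge_volume ?\<rho> (Suc m) x y)"
      unfolding survival.simps z
    proof (rule exponential_step_integral[OF l c])
      show "(\<integral>\<^sup>+u. ennreal (wedge_volume ?\<rho> m u y) * indicator {- y..x} u \<partial>lborel) = ennreal (wedge_volume ?\<rho> (Suc m) x y)"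
        by (rule wedge_volume_step_down[OF \<rho> xy True])
      have mono: "?\<rho> * u \<le> y" if "u \<le> x" for u
        using mult_left_mono[OF that \<rho>] xy by simp
      show "0 \<le> wedge_volume ?\<rho> m u y" if "- y \<le> u" "u \<le> x" for u
        using that mono by (intro wedge_volume_nonneg[OF \<rho>]) auto
      fix r :: real assume r: "0 \<le> r"
      have le: "x - ?c * r \<le> x" using r c by simp
      have "(x - ?c * r, y) \<in> safe c1 c2 \<longleftrightarrow> x - ?c * r \<in> {- y..x}"
        using mono[OF le] le by (auto simp: safe_iff)
      then show "indicator (safe c1 c2) (move ?c (Suc m) (x, y) r) * survival l c1 c2 m (move ?c (Suc m) (x, y) r)
         = indicator {- y..x} (x - ?c * r) *
           ennreal ((l / ?c) ^ m * exp (- l * (x + y - ?c * r) / ?c) * wedge_volume ?\<rho> m (x - ?c * r) y)"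
        using Suc.IH[of "(x - ?c * r, y)"] ev by (auto simp: move_def indicator_def algebra_simps)
    qed (use l c in auto)
    then show ?thesis by (simp add: z mult.commute)
  next
    case False
    have od: "odd (Suc m)" using False by simp
    have "survival l c1 c2 (Suc m) z = ennreal ((l / ?c) ^ m * (l / ?c) * exp (- l * (x + y) / ?c) * wedge_volume ?\<rho> (Suc m) x y)"
      unfolding survival.simps z
    proof (rule exponential_step_integral[OF l c])
      show "(\<integral>\<^sup>+u. ennreal (wedge_volume ?\<rho> m x u) * indicator {max (- x) (?\<rho> * x)..y} u \<partial>lborel) = ennreal (wedge_volume ?\<rho> (Suc m) x y)"
        by (rule wedge_volume_step_up[OF \<rho> xy]) (use False in simp)
      show "0 \<le> wedge_volume ?\<rho> m x u" if "max (- x) (?\<rho> * x) \<le> u" "u \<le> y" for u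
        using that by (intro wedge_volume_nonneg[OF \<rho>]) auto
      fix r :: real assume r: "0 \<le> r"
      have le: "y - ?c * r \<le> y" using r c by simp
      have "(x, y - ?c * r) \<in> safe c1 c2 \<longleftrightarrow> y - ?c * r \<in> {max (- x) (?\<rho> * x)..y}"
        using le by (auto simp: safe_iff)
      then show "indicator (safe c1 c2) (move ?c (Suc m) (x, y) r) * survival l c1 c2 m (move ?c (Suc m) (x, y) r)
         = indicator {max (- x) (?\<rho> * x)..y} (y - ?c * r) *
           ennreal ((l / ?c) ^ m * exp (- l * (x + y - ?c * r) / ?c) * wedge_volume ?\<rho> m x (y - ?c * r))"
        using Suc.IH[of "(x, y - ?c * r)"] od by (auto simp: move_def indicator_def algebra_simps)
    qed (use l c in auto)
    then show ?thesis by (simp add: z mult.commute)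
  qed
qed

section \<open>The telegraph process seen at its event times\<close>

primrec walk :: "real \<Rightarrow> (nat \<Rightarrow> real) \<Rightarrow> real \<times> real \<Rightarrow> nat \<Rightarrow> real \<times> real" where
  "walk c e z 0 = z"
| "walk c e z (Suc i) = move c i (walk c e z i) (e i)"

definition alive :: "real \<Rightarrow> real \<Rightarrow> real \<times> real \<Rightarrow> nat \<Rightarrow> (nat \<Rightarrow> real) \<Rightarrow> bool" where
  "alive c1 c2 z i e \<longleftrightarrow> (\<forall>j\<in>{..i}. walk (c1 + c2) e z j \<in> safe c1 c2)"

lemma move_parity: "even m \<longleftrightarrow> even m' \<Longrightarrow> move c m = move c m'"
  by (simp add: move_def fun_eq_iff)

lemma walk_cong: "(\<And>j. j < i \<Longrightarrow> e j = e' j) \<Longrightarrow> walk c e z i = walk c e' z i"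
  by (induction i) auto

lemma alive_cong: "(\<And>j. j < i \<Longrightarrow> e j = e' j) \<Longrightarrow> alive c1 c2 z i e = alive c1 c2 z i e'"
  unfolding alive_def by (intro ball_cong refl arg_cong2[where f = "(\<in>)"] walk_cong) auto

lemma alive_Suc: "alive c1 c2 z (Suc i) e \<longleftrightarrow> alive c1 c2 z i e \<and> walk (c1 + c2) e z (Suc i) \<in> safe c1 c2"
  by (auto simp: alive_def atMost_Suc)

lemma walk_measurable [measurable]:
  "j \<le> i \<Longrightarrow> (\<lambda>e. walk c e z j) \<in> borel_measurable (PiM {..<i} (\<lambda>_. borel))"
proof (induction j)
  case 0
  then show ?case by simp
next
  case (Suc j)
  have [measurable]: "(\<lambda>e. walk c e z j) \<in> borel_measurable (PiM {..<i} (\<lambda>_. borel))"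
    using Suc by simp
  have [measurable]: "(\<lambda>e. e j) \<in> borel_measurable (PiM {..<i} (\<lambda>_. borel))"
    using Suc.prems by (intro measurable_component_singleton) auto
  have "(\<lambda>e. (walk c e z j, e j)) \<in> measurable (PiM {..<i} (\<lambda>_. borel)) (borel \<Otimes>\<^sub>M borel)"
    by measurable
  from measurable_compose[OF this move_measurable[of c j]]
  show ?case by simp
qed

lemma alive_measurable [measurable]:
  "Measurable.pred (PiM {..<i} (\<lambda>_. borel)) (alive c1 c2 z i)"
proof -
  have "{e \<in> space (PiM {..<i} (\<lambda>_. borel)). walk (c1 + c2) e z j \<in> safe c1 c2} \<in> sets (PiM {..<i} (\<lambda>_. borel))"
    if "j \<le> i" for j
    using measurable_sets[OF walk_measurable[OF that] safe_measurable] by (simp add: vimage_def Int_def conj_commute)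
  then show ?thesis
    unfolding alive_def[abs_def] pred_def by (intro sets.sets_Collect_finite_All) auto
qed

lemma walk_coordinates:
  "walk (c1 + c2) e (c1 * t - \<beta>, c2 * t + \<beta>) i =
    (c1 * (t - (\<Sum>j<i. e j)) - (\<beta> - turning_point c1 c2 e i),
     c2 * (t - (\<Sum>j<i. e j)) + (\<beta> - turning_point c1 c2 e i))"
  by (induction i) (auto simp: turning_point_def move_def leg_speed_def algebra_simps)

text \<open>
  The time left and the distance left to the level are linear in the state; both have to be nonnegative.
\<close>

lemma walk_safe_iff:
  assumes "0 < c1" "0 < c2"
  shows "walk (c1 + c2) e (c1 * t - \<beta>, c2 * t + \<beta>) i \<in> safe c1 c2 \<longleftrightarrow>
    (\<Sum>j<i. e j) \<le> t \<and> turning_point c1 c2 e i \<le> \<beta>"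
proof -
  let ?s = "t - (\<Sum>j<i. e j)" and ?b = "\<beta> - turning_point c1 c2 e i"
  have "c1 * ?s - ?b + (c2 * ?s + ?b) = (c1 + c2) * ?s" by (simp add: algebra_simps)
  moreover have "c1 * (c2 * ?s + ?b) - c2 * (c1 * ?s - ?b) = (c1 + c2) * ?b" by (simp add: algebra_simps)
  ultimately have "walk (c1 + c2) e (c1 * t - \<beta>, c2 * t + \<beta>) i \<in> safe c1 c2 \<longleftrightarrow>
      0 \<le> (c1 + c2) * ?s \<and> 0 \<le> (c1 + c2) * ?b"
    unfolding walk_coordinates safe_def by (simp only: mem_Collect_eq fst_conv snd_conv) linarith
  then show ?thesis using assms by (simp add: zero_le_mult_iff)
qed

context poisson_process
begin

lemma walk_earlier: "j \<le> i \<Longrightarrow> walk c (earlier_waits i \<omega>) z j = walk c (\<lambda>j. waiting_time j \<omega>) z j"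
  by (rule walk_cong) (simp add: earlier_waits_def)

lemma alive_earlier: "alive c1 c2 z i (earlier_waits i \<omega>) = alive c1 c2 z i (\<lambda>j. waiting_time j \<omega>)"
  by (rule alive_cong) (simp add: earlier_waits_def)

text \<open>
  Passing from \<open>i\<close> to \<open>i + 1\<close> integrates out the waiting time of move \<open>i\<close>, which is what the recursion for
  \<open>survival\<close> does.
\<close>

lemma survival_martingale:
  assumes "even n" "i \<le> n"
  shows "(\<integral>\<^sup>+\<omega>. of_bool (alive c1 c2 z i (\<lambda>j. waiting_time j \<omega>)) *
      survival rate c1 c2 (n - i) (walk (c1 + c2) (\<lambda>j. waiting_time j \<omega>) z i) \<partial>M)
    = of_bool (z \<in> safe c1 c2) * survival rate c1 c2 n z"
  using assms(2)
proof (induction i)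
  case 0
  then show ?case by (simp add: alive_def emeasure_space_1)
next
  case (Suc i)
  let ?c = "c1 + c2" and ?P = "PiM {..<i} (\<lambda>_. borel) :: (nat \<Rightarrow> real) measure"
  \<comment> \<open>The walk counts the moves made, \<open>survival\<close> those left; the two parities agree since \<open>n\<close> is even.\<close>
  define m where "m = n - Suc i"
  have m: "n - i = Suc m" "n - Suc i = m" and n: "n = i + Suc m" using Suc.prems by (auto simp: m_def)
  have "even i \<longleftrightarrow> even (Suc m)" using assms(1) unfolding n by simp
  then have parity: "move ?c i = move ?c (Suc m)" by (rule move_parity)
  define \<phi> where "\<phi> e r = (of_bool (alive c1 c2 z i e) *
      (indicator (safe c1 c2) (move ?c i (walk ?c e z i) r) *
       survival rate c1 c2 m (move ?c i (walk ?c e z i) r)) :: ennreal)" for e r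
  have [measurable]: "(\<lambda>e. walk ?c e z i) \<in> borel_measurable ?P" by (rule walk_measurable) simp
  have "(\<lambda>p. (walk ?c (fst p) z i, snd p)) \<in> measurable (?P \<Otimes>\<^sub>M borel) (borel \<Otimes>\<^sub>M borel)"
    by measurable
  from measurable_compose[OF this move_measurable[of ?c i]]
  have [measurable]: "(\<lambda>p. move ?c i (walk ?c (fst p) z i) (snd p)) \<in> borel_measurable (?P \<Otimes>\<^sub>M borel)"
    by simp
  have [measurable]: "case_prod \<phi> \<in> borel_measurable (?P \<Otimes>\<^sub>M borel)"
    unfolding \<phi>_def case_prod_beta by measurable
  have "(\<integral>\<^sup>+\<omega>. of_bool (alive c1 c2 z (Suc i) (\<lambda>j. waiting_time j \<omega>)) *
      survival rate c1 c2 (n - Suc i) (walk ?c (\<lambda>j. waiting_time j \<omega>) z (Suc i)) \<partial>M)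
    = (\<integral>\<^sup>+\<omega>. \<phi> (earlier_waits i \<omega>) (waiting_time i \<omega>) \<partial>M)"
    unfolding \<phi>_def m alive_Suc alive_earlier walk_earlier[OF order_refl] walk.simps
    by (intro nn_integral_cong) (simp add: indicator_def)
  also have "\<dots> = (\<integral>\<^sup>+\<omega>. (\<integral>\<^sup>+r. ennreal (exponential_density rate r) * \<phi> (earlier_waits i \<omega>) r \<partial>lborel) \<partial>M)"
    by (rule nn_integral_waiting_time) measurable
  also have "\<dots> = (\<integral>\<^sup>+\<omega>. of_bool (alive c1 c2 z i (\<lambda>j. waiting_time j \<omega>)) *
      survival rate c1 c2 (n - i) (walk ?c (\<lambda>j. waiting_time j \<omega>) z i) \<partial>M)"
    unfolding \<phi>_def m alive_earlier walk_earlier[OF order_refl] survival.simps parity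
    by (intro nn_integral_cong) simp
  also have "\<dots> = of_bool (z \<in> safe c1 c2) * survival rate c1 c2 n z"
    using Suc by simp
  finally show ?case .
qed

lemma nn_integral_exponential_tail:
  assumes "0 \<le> s"
  shows "(\<integral>\<^sup>+r. ennreal (exponential_density rate r) * of_bool (s < r) \<partial>lborel) = ennreal (exp (- rate * s))"
proof -
  have "(\<integral>\<^sup>+r. ennreal (exponential_density rate r) * indicator {s<..} r \<partial>lborel)
      = emeasure M (waiting_time 0 -` {s<..} \<inter> space M)"
    by (rule distributed_emeasure[OF waiting_time_distributed, symmetric]) simp
  also have "waiting_time 0 -` {s<..} \<inter> space M = {\<omega>\<in>space M. s < waiting_time 0 \<omega>}" by auto
  also have "emeasure M \<dots> = ennreal (exp (- rate * s))"
    using exponential_distributedD_gt[OF waiting_time_distributed assms rate_pos]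
    by (simp add: emeasure_eq_measure mult.commute)
  finally show ?thesis by (simp add: indicator_def[abs_def] of_bool_def)
qed

text \<open>
  Up to a null set the event says that the walk is safe for \<open>n\<close> moves and that the next waiting time outlasts
  the remaining time. Conditioning on the first \<open>n\<close> waiting times gives the value of the martingale after \<open>n\<close>
  steps, and its initial value is \<open>survival\<close> at the initial state.
\<close>

lemma prob_turning_points_le:
  assumes c: "0 < c1" "0 < c2" and t: "0 < t" and \<beta>: "\<beta> \<in> {0..c1 * t}" and n: "even n"
  shows "prob {\<omega>\<in>space M. N t \<omega> = n \<and> (\<forall>j\<le>n. turning_point c1 c2 (\<lambda>j. waiting_time j \<omega>) j \<le> \<beta>)}
    = (rate / (c1 + c2)) ^ n * exp (- rate * t) * wedge_volume (c2 / c1) n (c1 * t - \<beta>) (c2 * t + \<beta>)"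
proof -
  let ?c = "c1 + c2" and ?z = "(c1 * t - \<beta>, c2 * t + \<beta>)"
  let ?P = "PiM {..<n} (\<lambda>_. borel) :: (nat \<Rightarrow> real) measure"
  let ?W = "\<lambda>\<omega> j. waiting_time j \<omega>"
  define rest where "rest e = (fst (walk ?c e ?z n) + snd (walk ?c e ?z n)) / ?c" for e
  have rest: "rest e = t - (\<Sum>j<n. e j)" for e
  proof -
    have "fst (walk ?c e ?z n) + snd (walk ?c e ?z n) = ?c * (t - (\<Sum>j<n. e j))"
      unfolding walk_coordinates by (simp add: algebra_simps)
    then show ?thesis using c by (simp add: rest_def)
  qed
  have alive_iff: "alive c1 c2 ?z n e \<longleftrightarrow> (\<forall>j\<le>n. (\<Sum>k<j. e k) \<le> t \<and> turning_point c1 c2 e j \<le> \<beta>)" for e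
    by (auto simp: alive_def walk_safe_iff[OF c])
  have z: "?z \<in> safe c1 c2"
    using walk_safe_iff[OF c, of "\<lambda>_. 0" t \<beta> 0] t \<beta> by (simp add: turning_point_def)
  define \<phi> where "\<phi> e r = (of_bool (alive c1 c2 ?z n e) * of_bool (rest e < r) :: ennreal)" for e r
  have [measurable]: "rest \<in> borel_measurable ?P"
    unfolding rest by measurable
  have [measurable]: "case_prod \<phi> \<in> borel_measurable (?P \<Otimes>\<^sub>M borel)"
    unfolding \<phi>_def case_prod_beta by measurable
  have rest_W: "rest (earlier_waits n \<omega>) = rest (?W \<omega>)" for \<omega>
    unfolding rest by (simp add: earlier_waits_def)
  let ?E = "{\<omega>\<in>space M. alive c1 c2 ?z n (?W \<omega>) \<and> rest (?W \<omega>) < waiting_time n \<omega>}"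
  have [measurable]: "?E \<in> events"
    unfolding alive_earlier[symmetric] rest_W[symmetric] by measurable
  have "emeasure M ?E = (\<integral>\<^sup>+\<omega>. indicator ?E \<omega> \<partial>M)"
    by (rule nn_integral_indicator[symmetric]) measurable
  also have "\<dots> = (\<integral>\<^sup>+\<omega>. \<phi> (earlier_waits n \<omega>) (waiting_time n \<omega>) \<partial>M)"
    by (intro nn_integral_cong) (simp add: \<phi>_def alive_earlier rest_W indicator_def)
  also have "\<dots> = (\<integral>\<^sup>+\<omega>. (\<integral>\<^sup>+r. ennreal (exponential_density rate r) * \<phi> (earlier_waits n \<omega>) r \<partial>lborel) \<partial>M)"
    by (rule nn_integral_waiting_time) measurable
  also have "\<dots> = (\<integral>\<^sup>+\<omega>. of_bool (alive c1 c2 ?z n (?W \<omega>)) *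
      survival rate c1 c2 (n - n) (walk ?c (?W \<omega>) ?z n) \<partial>M)"
  proof (rule nn_integral_cong)
    fix \<omega>
    have surv: "survival rate c1 c2 (n - n) (walk ?c (?W \<omega>) ?z n) = ennreal (exp (- rate * rest (?W \<omega>)))"
      by (simp add: rest_def)
    show "(\<integral>\<^sup>+r. ennreal (exponential_density rate r) * \<phi> (earlier_waits n \<omega>) r \<partial>lborel)
      = of_bool (alive c1 c2 ?z n (?W \<omega>)) * survival rate c1 c2 (n - n) (walk ?c (?W \<omega>) ?z n)"
    proof (cases "alive c1 c2 ?z n (?W \<omega>)")
      case True
      then have "0 \<le> rest (?W \<omega>)" unfolding rest alive_iff by auto
      from nn_integral_exponential_tail[OF this] True show ?thesis
        unfolding surv by (simp add: \<phi>_def alive_earlier rest_W)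
    next
      case False
      then show ?thesis by (simp add: \<phi>_def alive_earlier)
    qed
  qed
  also have "\<dots> = survival rate c1 c2 n ?z"
    unfolding survival_martingale[OF n order_refl] using z by simp
  also have "\<dots> = ennreal ((rate / ?c) ^ n * exp (- rate * t) * wedge_volume (c2 / c1) n (c1 * t - \<beta>) (c2 * t + \<beta>))"
  proof -
    have "rate * (c1 * t - \<beta> + (c2 * t + \<beta>)) / ?c = rate * t"
      using c by (simp add: field_simps)
    then show ?thesis by (subst survival_eq[OF rate_pos c z]) (simp add: minus_divide_left[symmetric] del: add_diff_eq)
  qed
  finally have E: "prob ?E = (rate / ?c) ^ n * exp (- rate * t) * wedge_volume (c2 / c1) n (c1 * t - \<beta>) (c2 * t + \<beta>)"
  proof (subst (asm) emeasure_eq_measure, subst (asm) ennreal_inj)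
    have "0 \<le> c2 / c1" "0 \<le> c1 * t - \<beta> + (c2 * t + \<beta>)" "c2 / c1 * (c1 * t - \<beta>) \<le> c2 * t + \<beta>"
      using z c by (auto simp: safe_def field_simps)
    from wedge_volume_nonneg[OF this] show "0 \<le> (rate / ?c) ^ n * exp (- rate * t) * wedge_volume (c2 / c1) n (c1 * t - \<beta>) (c2 * t + \<beta>)"
      using c rate_pos by simp
  qed simp_all
  have [measurable]: "N t \<in> measurable M (count_space UNIV)" using t by (intro count_measurable) simp
  have "prob {\<omega>\<in>space M. N t \<omega> = n \<and> (\<forall>j\<le>n. turning_point c1 c2 (?W \<omega>) j \<le> \<beta>)} = prob ?E"
  proof (rule finite_measure_eq_AE)
    show "AE \<omega> in M. \<omega> \<in> {\<omega>\<in>space M. N t \<omega> = n \<and> (\<forall>j\<le>n. turning_point c1 c2 (?W \<omega>) j \<le> \<beta>)} \<longleftrightarrow> \<omega> \<in> ?E"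
      using AE_unbounded AE_space
    proof eventually_elim
      fix \<omega> assume reach: "\<forall>j. \<exists>s\<ge>0. j \<le> N s \<omega>" and \<omega>: "\<omega> \<in> space M"
      interpret counting_path "\<lambda>s. N s \<omega>" by (rule path[OF \<omega>])
      have le_iff: "J j \<omega> \<le> t \<longleftrightarrow> j \<le> N t \<omega>" for j
        unfolding J_def using jump_time_le_iff reach t by simp
      have J_sum: "(\<Sum>k<j. waiting_time k \<omega>) = J j \<omega>" for j
        unfolding waiting_time_def J_def by (rule sum_gap)
      have "rest (?W \<omega>) < waiting_time n \<omega> \<longleftrightarrow> \<not> J (Suc n) \<omega> \<le> t"
        using rest[of "?W \<omega>"] J_sum[of n] waiting_time_eq[of n \<omega>] by linarith
      moreover have "alive c1 c2 ?z n (?W \<omega>) \<longleftrightarrow> (\<forall>j\<le>n. J j \<omega> \<le> t \<and> turning_point c1 c2 (?W \<omega>) j \<le> \<beta>)"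
        unfolding alive_iff using J_sum by metis
      ultimately have "\<omega> \<in> ?E \<longleftrightarrow> (\<forall>j\<le>n. j \<le> N t \<omega> \<and> turning_point c1 c2 (?W \<omega>) j \<le> \<beta>) \<and> \<not> Suc n \<le> N t \<omega>"
        using \<omega> unfolding le_iff by blast
      also have "\<dots> \<longleftrightarrow> N t \<omega> = n \<and> (\<forall>j\<le>n. turning_point c1 c2 (?W \<omega>) j \<le> \<beta>)"
        by auto
      finally show "\<omega> \<in> {\<omega>\<in>space M. N t \<omega> = n \<and> (\<forall>j\<le>n. turning_point c1 c2 (?W \<omega>) j \<le> \<beta>)} \<longleftrightarrow> \<omega> \<in> ?E"
        using \<omega> by simp
    qed
  qed (unfold turning_point_def, measurable)
  with E show ?thesis by simp
qed

end

lemma turning_points_event: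
  assumes [measurable]: "n \<in> measurable A (count_space UNIV)" "\<And>j. e j \<in> borel_measurable A"
  shows "{\<omega>\<in>space A. n \<omega> = (m :: nat) \<and> (\<forall>j\<le>m. turning_point c1 c2 (\<lambda>j. e j \<omega>) j \<le> \<beta>)} \<in> sets A"
  unfolding turning_point_def by measurable

section \<open>The conditional law of the maximum\<close>

lemma wedge_volume_eq_binomial_sum:
  assumes "0 \<le> x" "0 < s"
  shows "wedge_volume \<rho> (2 * k) x y * fact (2 * k) / s ^ (2 * k) =
    (\<Sum>j=0..k. real ((2 * k) choose j) * (x ^ j * y ^ (2 * k - j) / s ^ (2 * k)))
    - (\<Sum>j<k. real ((2 * k) choose j) * \<rho> ^ (2 * k - 1 - 2 * j) * (x ^ (2 * k - j) * y ^ j / s ^ (2 * k)))"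
proof -
  have wedge_volume: "wedge_volume \<rho> (2 * k) x y = down_poly \<rho> k x y"
    using assms(1) by (auto simp: wedge_volume_def down_poly_0)
  have 1: "divided_power x j * divided_power y (2 * k - j) * fact (2 * k) / s ^ (2 * k)
      = real ((2 * k) choose j) * (x ^ j * y ^ (2 * k - j) / s ^ (2 * k))" if "j \<le> k" for j
    using that by (simp add: divided_power_def binomial_fact)
  have 2: "\<rho> ^ (2 * k - 1 - 2 * j) * divided_power x (2 * k - j) * divided_power y j * fact (2 * k) / s ^ (2 * k)
      = real ((2 * k) choose j) * \<rho> ^ (2 * k - 1 - 2 * j) * (x ^ (2 * k - j) * y ^ j / s ^ (2 * k))" if "j < k" for j
    using that by (simp add: divided_power_def binomial_fact mult_ac)
  have "(\<Sum>j\<le>k. divided_power x j * divided_power y (2 * k - j)) * fact (2 * k) / s ^ (2 * k)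
      = (\<Sum>j=0..k. real ((2 * k) choose j) * (x ^ j * y ^ (2 * k - j) / s ^ (2 * k)))"
    unfolding sum_distrib_right sum_divide_distrib atMost_atLeast0 by (rule sum.cong[OF refl 1]) simp
  moreover have "(\<Sum>j<k. \<rho> ^ (2 * k - 1 - 2 * j) * divided_power x (2 * k - j) * divided_power y j) * fact (2 * k) / s ^ (2 * k)
      = (\<Sum>j<k. real ((2 * k) choose j) * \<rho> ^ (2 * k - 1 - 2 * j) * (x ^ (2 * k - j) * y ^ j / s ^ (2 * k)))"
    unfolding sum_distrib_right sum_divide_distrib by (rule sum.cong[OF refl 2]) simp
  ultimately show ?thesis
    unfolding wedge_volume down_poly_def left_diff_distrib diff_divide_distrib by simp
qed

context asymmetric_telegraph
begin

text \<open>
  The \<open>\<sigma>\<close>-algebra of \<open>N\<close> with respect to which the independence of the initial velocity is given.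
\<close>

abbreviation path_algebra :: "'a measure" where
  "path_algebra \<equiv> vimage_algebra (space M) (\<lambda>\<omega>. \<lambda>s\<in>{0..}. N s \<omega>)
     (\<Pi>\<^sub>M s\<in>{0::real..}. count_space (UNIV :: nat set))"

lemma N_path_algebra:
  assumes "0 \<le> s"
  shows "N s \<in> measurable path_algebra (count_space UNIV)"
proof -
  have "(\<lambda>\<omega>. \<lambda>s\<in>{0..}. N s \<omega>) \<in> measurable path_algebra (\<Pi>\<^sub>M s\<in>{0::real..}. count_space (UNIV :: nat set))"
    by (rule measurable_vimage_algebra1) (auto simp: space_PiM)
  from measurable_compose[OF this measurable_component_singleton[of s]] assms
  show ?thesis by simp
qed

lemma waiting_time_path_algebra: "waiting_time j \<in> borel_measurable path_algebra"
  unfolding waiting_time_def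
  by (intro borel_measurable_diff jump_time_measurable) (auto simp: N_path_algebra path)

lemma prob_initially_down:
  assumes "E \<in> sets path_algebra"
  shows "prob ({\<omega>\<in>space M. V0 \<omega> = - c2} \<inter> E) = prob E / 2"
proof -
  have "V0 -` {- c2} \<inter> space M \<in> sets (vimage_algebra (space M) V0 borel)"
    by (rule in_vimage_algebra) simp
  also have "V0 -` {- c2} \<inter> space M = {\<omega>\<in>space M. V0 \<omega> = - c2}" by auto
  finally show ?thesis
    using indep_setD[OF V0_indep_N _ assms] V0_down by simp
qed

text \<open>
  Both the conditioning event and its intersection with the event in question are the event \<open>V0 = - c2\<close>
  intersected with an event of the counting process, so the factor \<open>1 / 2\<close> cancels, and the factors
  \<open>rate ^ (2 * k)\<close> and \<open>exp (- rate * t)\<close> cancel as well.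
\<close>

lemma prob_running_max_le:
  assumes t: "0 < t" and \<beta>: "\<beta> \<in> {0..c1 * t}"
  shows "\<P>(\<omega> in M. running_max (telegraph c1 c2 V0 N) t \<omega> \<le> \<beta>
      \<bar> velocity c1 c2 V0 N 0 \<omega> = - c2 \<and> N t \<omega> = 2 * k)
    = wedge_volume (c2 / c1) (2 * k) (c1 * t - \<beta>) (c2 * t + \<beta>) * fact (2 * k) / ((c1 + c2) * t) ^ (2 * k)"
proof -
  let ?W = "\<lambda>\<omega> j. waiting_time j \<omega>"
  let ?A = "{\<omega>\<in>space M. V0 \<omega> = - c2}"
  let ?B = "{\<omega>\<in>space M. N t \<omega> = 2 * k}"
  let ?G = "{\<omega>\<in>space M. N t \<omega> = 2 * k \<and> (\<forall>j\<le>2 * k. turning_point c1 c2 (?W \<omega>) j \<le> \<beta>)}"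
  have v0: "velocity c1 c2 V0 N 0 \<omega> = V0 \<omega>" if "\<omega> \<in> space M" for \<omega>
    using count_zero[OF that] by (simp add: velocity_def)
  have cond: "{\<omega>\<in>space M. velocity c1 c2 V0 N 0 \<omega> = - c2 \<and> N t \<omega> = 2 * k} = ?A \<inter> ?B"
    using v0 by auto
  have max: "{\<omega>\<in>space M. running_max (telegraph c1 c2 V0 N) t \<omega> \<le> \<beta> \<and>
      (velocity c1 c2 V0 N 0 \<omega> = - c2 \<and> N t \<omega> = 2 * k)} = ?A \<inter> ?G"
  proof -
    have "running_max (telegraph c1 c2 V0 N) t \<omega> \<le> \<beta> \<longleftrightarrow> (\<forall>j\<le>2 * k. turning_point c1 c2 (?W \<omega>) j \<le> \<beta>)"
      if "\<omega> \<in> space M" "V0 \<omega> = - c2" "N t \<omega> = 2 * k" for \<omega>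
      using running_max_le_iff[where N = N and \<omega> = \<omega> and ?V0.0 = V0 and k = k and t = t and \<beta> = \<beta>,
          OF c1_pos c2_pos] path[OF that(1)] that t \<beta>
      by (simp add: waiting_time_def)
    then show ?thesis using v0 by auto
  qed
  have B: "?B \<in> sets path_algebra"
  proof -
    have "N t -` {2 * k} \<inter> space path_algebra \<in> sets path_algebra"
      using t by (intro measurable_sets[OF N_path_algebra]) auto
    also have "N t -` {2 * k} \<inter> space path_algebra = ?B" by auto
    finally show ?thesis .
  qed
  have G: "?G \<in> sets path_algebra"
  proof -
    have "{\<omega>\<in>space path_algebra. N t \<omega> = 2 * k \<and> (\<forall>j\<le>2 * k. turning_point c1 c2 (?W \<omega>) j \<le> \<beta>)} \<in> sets path_algebra"
      by (rule turning_points_event) (use t in \<open>auto intro: N_path_algebra waiting_time_path_algebra\<close>)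
    then show ?thesis by simp
  qed
  have even_2k: "even (2 * k)" by simp
  have probB: "prob ?B = (rate * t) ^ (2 * k) / fact (2 * k) * exp (- rate * t)"
  proof -
    have "?B = {\<omega>\<in>space M. N (0 + t) \<omega> - N 0 \<omega> \<in> {2 * k}}" by (auto simp: count_zero)
    then show ?thesis using prob_increment[of 0 t "{2 * k}"] rate_pos t by (simp add: measure_pmf_single)
  qed
  have "\<P>(\<omega> in M. running_max (telegraph c1 c2 V0 N) t \<omega> \<le> \<beta>
      \<bar> velocity c1 c2 V0 N 0 \<omega> = - c2 \<and> N t \<omega> = 2 * k) = prob ?G / prob ?B"
    unfolding cond_prob_def cond max prob_initially_down[OF B] prob_initially_down[OF G] by simp
  also have "\<dots> = wedge_volume (c2 / c1) (2 * k) (c1 * t - \<beta>) (c2 * t + \<beta>) * fact (2 * k) / ((c1 + c2) * t) ^ (2 * k)"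
    unfolding probB prob_turning_points_le[OF c1_pos c2_pos t \<beta> even_2k]
    using rate_pos t c1_pos c2_pos by (simp add: power_mult_distrib power_divide)
  finally show ?thesis .
qed

end

theorem theorem3p1:
  fixes M :: "'a measure" and N :: "real \<Rightarrow> 'a \<Rightarrow> nat" and V0 :: "'a \<Rightarrow> real"
    and rate c1 c2 t \<beta> :: real and k :: nat
  assumes "asymmetric_telegraph M rate N c1 c2 V0"
    and "0 < t"
    and "\<beta> \<in> {0..c1 * t}"
  shows "\<P>(\<omega> in M. running_max (telegraph c1 c2 V0 N) t \<omega> \<le> \<beta>
              \<bar> velocity c1 c2 V0 N 0 \<omega> = - c2 \<and> N t \<omega> = 2 * k) =
    (\<Sum>j=0..k. real ((2 * k) choose j) *
        ((c1 * t - \<beta>) ^ j * (c2 * t + \<beta>) ^ (2 * k - j) / ((c1 + c2) * t) ^ (2 * k)))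
    - (\<Sum>j<k. real ((2 * k) choose j) * (c2 / c1) ^ (2 * k - 1 - 2 * j) *
        ((c1 * t - \<beta>) ^ (2 * k - j) * (c2 * t + \<beta>) ^ j / ((c1 + c2) * t) ^ (2 * k)))"
proof -
  interpret asymmetric_telegraph M rate N c1 c2 V0 by fact
  have "0 \<le> c1 * t - \<beta>" "0 < (c1 + c2) * t" using assms c1_pos c2_pos by auto
  then show ?thesis
    unfolding prob_running_max_le[OF assms(2,3)] by (rule wedge_volume_eq_binomial_sum)
qed

end
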